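(* Let $D\ge 2$. There exist constants $c,C'>0$ depending only on $D$ such that the following holds. Let $E\subset\mathbb R^D$ be finite with $\mathrm{card}(E)\leq D+1$, let $0<\varepsilon<c$ and set $\delta=\exp(-C'/\varepsilon)$. Let $\phi:E\to\mathbb R^D$ satisfy $(1+\delta)^{-1}|x-y|\leq|\phi(x)-\phi(y)|\leq(1+\delta)|x-y|$ for all $x,y\in E$. Then there exists an $\varepsilon$-distorted diffeomorphism $\Phi:\mathbb R^D\to\mathbb R^D$ with $\Phi=\phi$ on $E$.
   Context: For $\varepsilon>0$, an $\varepsilon$-distorted diffeomorphism is a diffeomorphism $\Phi$ of $\mathbb R^D$ onto $\mathbb R^D$ with $(1+\varepsilon)^{-1}I\leq(\nabla\Phi(x))^T\nabla\Phi(x)\leq(1+\varepsilon)I$ as matrices for all $x\in\mathbb R^D$. *)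

theory Defs
  imports "HOL-Analysis.Analysis"
begin

definition psd_le :: "real^'n^'n \<Rightarrow> real^'n^'n \<Rightarrow> bool" where
  "psd_le A B \<longleftrightarrow> (\<forall>v::real^'n. v \<bullet> (A *v v) \<le> v \<bullet> (B *v v))"

definition jac :: "(real^'n \<Rightarrow> real^'n) \<Rightarrow> real^'n \<Rightarrow> real^'n^'n" where
  "jac f x = matrix (frechet_derivative f (at x))"

definition C1_map :: "(real^'n \<Rightarrow> real^'n) \<Rightarrow> bool" where
  "C1_map f \<longleftrightarrow> (\<forall>x. f differentiable (at x)) \<and> continuous_on UNIV (jac f)"

definition diffeomorphism :: "(real^'n \<Rightarrow> real^'n) \<Rightarrow> bool" where
  "diffeomorphism f \<longleftrightarrow> bij f \<and> C1_map f \<and> C1_map (inv f)"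

definition eps_distorted :: "real \<Rightarrow> (real^'n \<Rightarrow> real^'n) \<Rightarrow> bool" where
  "eps_distorted \<epsilon> \<Phi> \<longleftrightarrow> diffeomorphism \<Phi> \<and>
     (\<forall>x. psd_le ((1 / (1 + \<epsilon>)) *\<^sub>R mat 1) (transpose (jac \<Phi> x) ** jac \<Phi> x)
        \<and> psd_le (transpose (jac \<Phi> x) ** jac \<Phi> x) ((1 + \<epsilon>) *\<^sub>R mat 1))"

end

theory Submission
  imports Defs
begin

text \<open>
  By induction on the number of points. If all distances in \<open>E\<close> are comparable up to a factor
  \<open>exp (O(1/\<epsilon>))\<close>, then comparing Gram matrices shows that \<open>\<phi>\<close> is within \<open>O(sqrt \<delta>)\<close> of a product of
  reflections; the remaining error is removed by moving each point separately. Otherwise \<open>E\<close>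
  contains a proper cluster that is separated from the rest by a factor \<open>exp (O(1/\<epsilon>))\<close>: collapse
  the cluster to one point, extend, and insert an extension of the map of the cluster.

  What makes both steps cost only \<open>O(\<epsilon>)\<close> of distortion is that a product of two reflections can be
  deformed to the identity over the range of scales \<open>r \<le> norm x \<le> r * exp (64/\<epsilon>)\<close>. The orientation is
  free because at most \<open>D\<close> points lie in a hyperplane, and with \<open>D + 1\<close> points every cluster and every
  collapsed set has at most \<open>D\<close> points.
\<close>

subsection \<open>Distorted diffeomorphisms\<close>

text \<open>Turning a mirror by a fixed angle at speed \<epsilon> per unit of
  \<open>ln (norm x)\<close> takes a range of scales of ratio exp (O(1/\<epsilon>)); all
  exponentials come from this. The same kind of ratio decides which distances count as comparable,
  and \<delta> has to beat both: the reflections miss the targets by O(sqrt \<delta>) times the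
  diameter, while a point may be moved only by a distance that is smaller than the separation by one
  more such ratio.

  The obstacle is to glue maps built at different scales without paying for the transition.
  Composition does this when one map is exactly a rigid motion where the other one acts. Exactness
  matters because the inserted map has to meet prescribed values after the outer map has been
  applied. Distortions add under composition, so the allowance is halved at each splitting; with at
  most D + 1 points this happens boundedly often and affects only the constant.\<close>

lemma C1_mapI:
  fixes f :: "real^'n \<Rightarrow> real^'n"
  assumes "\<And>x. (f has_derivative f' x) (at x)" "\<And>h. continuous_on UNIV (\<lambda>x. f' x h)"
  shows "C1_map f"
proof -
  have eq: "frechet_derivative f (at x) = f' x" for x
    using frechet_derivative_at[OF assms(1)] by simp
  have "continuous_on UNIV (\<lambda>x. \<chi> i j. f' x (axis j 1) $ i)"
    by (intro continuous_intros assms(2))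
  then have "continuous_on UNIV (jac f)"
    unfolding jac_def eq matrix_def by simp
  moreover have "f differentiable (at x)" for x
    using assms(1) differentiable_def by blast
  ultimately show ?thesis unfolding C1_map_def by blast
qed

lemma jac_mult:
  fixes f :: "real^'n \<Rightarrow> real^'n"
  assumes "(f has_derivative f') (at x)"
  shows "jac f x *v h = f' h"
proof -
  have "(*v) (matrix f') = f'"
    using matrix_vector_mul(2)[OF has_derivative_linear[OF assms]] .
  then show ?thesis
    unfolding jac_def frechet_derivative_at[OF assms, symmetric] by (rule fun_cong)
qed

lemma C1_map_has_derivative:
  fixes f :: "real^'n \<Rightarrow> real^'n"
  assumes "C1_map f"
  shows "(f has_derivative (\<lambda>h. jac f x *v h)) (at x)"
proof -
  have d: "f differentiable (at x)" using assms unfolding C1_map_def by blast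
  then have "(f has_derivative frechet_derivative f (at x)) (at x)"
    using frechet_derivative_works by blast
  moreover from jac_mult[OF this] have "frechet_derivative f (at x) = (\<lambda>h. jac f x *v h)"
    by auto
  ultimately show ?thesis by simp
qed

lemma C1_map_compose:
  fixes f g :: "real^'n \<Rightarrow> real^'n"
  assumes "C1_map f" "C1_map g"
  shows "C1_map (f \<circ> g)"
proof (rule C1_mapI)
  show "(f \<circ> g has_derivative (\<lambda>h. jac f (g x) *v (jac g x *v h))) (at x)" for x
    using diff_chain_at[OF C1_map_has_derivative[OF assms(2)] C1_map_has_derivative[OF assms(1)]]
    by (simp add: o_def)
  have cg: "continuous_on UNIV g"
    using assms(2) unfolding C1_map_def
    by (meson continuous_at_imp_continuous_on differentiable_imp_continuous_within)
  have cf: "continuous_on UNIV (\<lambda>x. jac f (g x))"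
    using continuous_on_compose2[OF _ cg, of UNIV "jac f"] assms(1) unfolding C1_map_def by simp
  have "continuous_on UNIV (jac g)" using assms(2) unfolding C1_map_def by simp
  then show "continuous_on UNIV (\<lambda>x. jac f (g x) *v (jac g x *v h))" for h
    unfolding matrix_vector_mult_def vec_lambda_beta by (intro continuous_intros cf)
qed

lemma diffeomorphism_compose:
  fixes f g :: "real^'n \<Rightarrow> real^'n"
  assumes "diffeomorphism f" "diffeomorphism g"
  shows "diffeomorphism (f \<circ> g)"
proof -
  have "inv (f \<circ> g) = inv g \<circ> inv f"
    using assms o_inv_distrib unfolding diffeomorphism_def by blast
  then show ?thesis
    using assms unfolding diffeomorphism_def by (simp add: bij_comp C1_map_compose)
qed

text \<open>Bounds by \<open>exp (- e)\<close> and \<open>exp e\<close> on the derivative multiply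
  under composition, so the distortion parameters simply add; the matrix inequalities of
  \<open>eps_distorted\<close> are recovered once, at the end.\<close>

definition distorted :: "real \<Rightarrow> (real^'n \<Rightarrow> real^'n) \<Rightarrow> bool" where
  "distorted e f \<longleftrightarrow> diffeomorphism f \<and>
     (\<forall>x h. exp (- e) * norm h \<le> norm (jac f x *v h) \<and> norm (jac f x *v h) \<le> exp e * norm h)"

lemma distortedI:
  fixes f :: "real^'n \<Rightarrow> real^'n"
  assumes "diffeomorphism f"
    and "\<And>x. (f has_derivative f' x) (at x)"
    and "\<And>x h. exp (- e) * norm h \<le> norm (f' x h)" "\<And>x h. norm (f' x h) \<le> exp e * norm h"
  shows "distorted e f"
  unfolding distorted_def using assms jac_mult[OF assms(2)] by simp

lemma distorted_mono: "distorted e f \<Longrightarrow> e \<le> e' \<Longrightarrow> distorted e' f"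
  unfolding distorted_def
  by (meson exp_le_cancel_iff mult_right_mono neg_le_iff_le norm_ge_zero order_trans)

lemma distorted_bij: "distorted e f \<Longrightarrow> bij f"
  unfolding distorted_def diffeomorphism_def by blast

lemma distorted_compose:
  fixes f g :: "real^'n \<Rightarrow> real^'n"
  assumes f: "distorted a f" and g: "distorted b g"
  shows "distorted (a + b) (f \<circ> g)"
proof (rule distortedI)
  show "diffeomorphism (f \<circ> g)"
    using f g diffeomorphism_compose unfolding distorted_def by blast
  have "C1_map f" "C1_map g" using f g unfolding distorted_def diffeomorphism_def by auto
  then show "(f \<circ> g has_derivative (\<lambda>h. jac f (g x) *v (jac g x *v h))) (at x)" for x
    using diff_chain_at[OF C1_map_has_derivative C1_map_has_derivative] by (simp add: o_def)
  show "exp (- (a + b)) * norm h \<le> norm (jac f (g x) *v (jac g x *v h))" for x h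
  proof -
    have "exp (- (a + b)) * norm h = exp (- a) * (exp (- b) * norm h)"
      by (simp add: exp_diff exp_minus exp_add field_simps)
    also have "\<dots> \<le> exp (- a) * norm (jac g x *v h)"
      using g unfolding distorted_def by simp
    also have "\<dots> \<le> norm (jac f (g x) *v (jac g x *v h))"
      using f unfolding distorted_def by simp
    finally show ?thesis .
  qed
  show "norm (jac f (g x) *v (jac g x *v h)) \<le> exp (a + b) * norm h" for x h
  proof -
    have "norm (jac f (g x) *v (jac g x *v h)) \<le> exp a * norm (jac g x *v h)"
      using f unfolding distorted_def by simp
    also have "\<dots> \<le> exp a * (exp b * norm h)"
      using g unfolding distorted_def by simp
    finally show ?thesis by (simp add: exp_add)
  qed
qed

lemma distorted_compose_le:
  fixes f g :: "real^'n \<Rightarrow> real^'n"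
  assumes "distorted a f" "distorted b g" "a + b \<le> c"
  shows "distorted c (\<lambda>x. f (g x))"
  using distorted_mono[OF distorted_compose[OF assms(1,2)] assms(3)] by (simp add: o_def)

lemma distorted_affine_isometry:
  fixes f :: "real^'n \<Rightarrow> real^'n"
  assumes "orthogonal_transformation f"
  shows "distorted 0 (\<lambda>x. a + f (x - b))"
proof -
  have C1: "C1_map (\<lambda>x. c + h (x - d))" and der: "((\<lambda>x. c + h (x - d)) has_derivative h) (at x)"
    if "linear h" for h :: "real^'n \<Rightarrow> real^'n" and c d x
  proof -
    have l: "bounded_linear h" using that linear_conv_bounded_linear by blast
    show d: "((\<lambda>x. c + h (x - d)) has_derivative h) (at x)" for x
      by (rule derivative_eq_intros bounded_linear.has_derivative[OF l] | simp)+
    show "C1_map (\<lambda>x. c + h (x - d))"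
      by (rule C1_mapI[OF d]) simp
  qed
  have lin: "linear f" "linear (inv f)" and bij: "bij f"
    using assms by (auto simp: orthogonal_transformation_linear orthogonal_transformation_inv
        orthogonal_transformation_bij)
  have r: "f (inv f y) = y" and l: "inv f (f y) = y" for y
    using bij by (simp_all add: bij_is_inj bij_is_surj surj_f_inv_f)
  have b: "bij (\<lambda>x. a + f (x - b))"
    by (rule o_bij[where g = "\<lambda>y. b + inv f (y - a)"]) (auto simp: r l)
  have "inv (\<lambda>x. a + f (x - b)) = (\<lambda>y. b + inv f (y - a))"
    by (rule inv_equality) (auto simp: r l)
  then have "diffeomorphism (\<lambda>x. a + f (x - b))"
    unfolding diffeomorphism_def using b C1[OF lin(1)] C1[OF lin(2)] by simp
  then show ?thesis
    by (rule distortedI[OF _ der[OF lin(1)]]) (simp_all add: orthogonal_transformation_norm[OF assms])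
qed

lemma distorted_id: "distorted 0 (\<lambda>x::real^'n. x)"
  using distorted_affine_isometry[of "\<lambda>x. x" 0 0] by simp

text \<open>The quadratic form of the matrix product is the square of
  \<open>norm (jac f x *v v)\<close>. Squaring turns \<epsilon>/4 into \<epsilon>/2, and
  \<open>exp (\<epsilon> / 2) \<le> 1 + \<epsilon>\<close> then serves both sides.\<close>

lemma distorted_imp_eps_distorted:
  fixes f :: "real^'n \<Rightarrow> real^'n"
  assumes f: "distorted (\<epsilon> / 4) f" and e: "0 < \<epsilon>" "\<epsilon> \<le> 1"
  shows "eps_distorted \<epsilon> f"
proof -
  have eb: "exp (\<epsilon> / 2) \<le> 1 + \<epsilon>"
  proof -
    have "exp (\<epsilon> / 2) \<le> 1 + \<epsilon> / 2 + (\<epsilon> / 2)\<^sup>2"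
      using e by (intro exp_bound) auto
    also have "\<dots> \<le> 1 + \<epsilon>"
      using mult_left_mono[of \<epsilon> 1 \<epsilon>] e unfolding power2_eq_square by linarith
    finally show ?thesis .
  qed
  have "v \<bullet> ((c *\<^sub>R mat 1) *v v) = c * (norm v)\<^sup>2" for c and v :: "real^'n"
    by (simp add: scaleR_matrix_vector_assoc[symmetric] power2_norm_eq_inner)
  moreover have "v \<bullet> ((transpose (jac f x) ** jac f x) *v v) = (norm (jac f x *v v))\<^sup>2" for x v
    unfolding matrix_vector_mul_assoc[symmetric] transpose_matrix_vector
    by (simp add: power2_norm_eq_inner inner_commute[of v] dot_lmul_matrix)
  moreover have "(norm (jac f x *v v))\<^sup>2 \<le> (1 + \<epsilon>) * (norm v)\<^sup>2"
    and "1 / (1 + \<epsilon>) * (norm v)\<^sup>2 \<le> (norm (jac f x *v v))\<^sup>2" for x v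
  proof -
    have up: "norm (jac f x *v v) \<le> exp (\<epsilon>/4) * norm v"
      and lo: "exp (- (\<epsilon>/4)) * norm v \<le> norm (jac f x *v v)"
      using f unfolding distorted_def by auto
    have sq: "(exp (\<epsilon>/4))\<^sup>2 = exp (\<epsilon>/2)" "(exp (- (\<epsilon>/4)))\<^sup>2 = exp (- (\<epsilon>/2))"
      by (simp_all add: exp_double[symmetric])
    have "(norm (jac f x *v v))\<^sup>2 \<le> exp (\<epsilon>/2) * (norm v)\<^sup>2"
      using power_mono[OF up, of 2] by (simp add: power_mult_distrib sq)
    also have "\<dots> \<le> (1 + \<epsilon>) * (norm v)\<^sup>2"
      using eb by (intro mult_right_mono) auto
    finally show "(norm (jac f x *v v))\<^sup>2 \<le> (1 + \<epsilon>) * (norm v)\<^sup>2" .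
    have "1 / (1 + \<epsilon>) * (norm v)\<^sup>2 \<le> exp (- (\<epsilon>/2)) * (norm v)\<^sup>2"
      using eb e by (intro mult_right_mono) (auto simp: exp_minus field_simps)
    also have "\<dots> \<le> (norm (jac f x *v v))\<^sup>2"
      using power_mono[OF lo, of 2] by (simp add: power_mult_distrib sq)
    finally show "1 / (1 + \<epsilon>) * (norm v)\<^sup>2 \<le> (norm (jac f x *v v))\<^sup>2" .
  qed
  ultimately show ?thesis
    using f unfolding eps_distorted_def psd_le_def distorted_def by simp
qed

subsection \<open>Slowly varying reflections\<close>

text \<open>The normal is not normalised, so a moving mirror can be described by a normal of varying
  length. For \<open>v = 0\<close> the formula gives the identity.\<close>

definition reflect :: "'a::real_inner \<Rightarrow> 'a \<Rightarrow> 'a" where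
  "reflect v x = x - (2 * (x \<bullet> v) / (v \<bullet> v)) *\<^sub>R v"

lemma reflect_orthogonal_transformation: "orthogonal_transformation (reflect v)"
  unfolding orthogonal_transformation_def
proof (intro conjI allI)
  show "linear (reflect v)"
    unfolding reflect_def
    by (intro linearI) (auto simp: algebra_simps inner_add_left add_divide_distrib)
  fix x y
  show "reflect v x \<bullet> reflect v y = x \<bullet> y"
    by (cases "v = 0")
      (simp_all add: reflect_def inner_diff_left inner_diff_right inner_commute field_simps)
qed

lemma norm_reflect [simp]: "norm (reflect v x) = norm x"
  using reflect_orthogonal_transformation orthogonal_transformation by blast

lemma reflect_reflect [simp]: "reflect v (reflect v x) = x"
  by (cases "v = 0")
    (simp_all add: reflect_def inner_diff_left field_simps scaleR_add_left[symmetric])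

lemma reflect_eq_self: "x \<bullet> v = 0 \<Longrightarrow> reflect v x = x"
  by (simp add: reflect_def)

lemma reflect_scaleR: "c \<noteq> 0 \<Longrightarrow> reflect (c *\<^sub>R v) = reflect v"
  by (rule ext) (simp add: reflect_def)

lemma reflect_self: "reflect v (c *\<^sub>R v) = - (c *\<^sub>R v)"
proof (cases "v = 0")
  case False
  then have "reflect v (c *\<^sub>R v) = (c - 2 * c) *\<^sub>R v"
    unfolding reflect_def scaleR_diff_left by simp
  then show ?thesis by simp
qed (simp add: reflect_def)

lemma reflect_swap:
  assumes "norm u = norm w"
  shows "reflect (u - w) u = w"
proof (cases "u = w")
  case False
  have "2 * (u \<bullet> (u - w)) = (u - w) \<bullet> (u - w)"
    using assms unfolding norm_eq by (simp add: inner_diff_left inner_diff_right inner_commute)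
  then show ?thesis
    using False by (simp add: reflect_def)
qed (simp add: reflect_def)

section \<open>Cutoffs and mirrors that vary with the scale\<close>

text \<open>The derivative is the tent of height 2 over the unit interval, a combination of positive
  parts of shifted variables; integrating these gives the truncated squares
  \<open>p\<close>.\<close>

lemma C1_smooth_step:
  obtains h h' :: "real \<Rightarrow> real"
  where "\<And>t. (h has_real_derivative h' t) (at t)" "continuous_on UNIV h'"
    "\<And>t. 0 \<le> h t" "\<And>t. h t \<le> 1" "\<And>t. t \<le> 0 \<Longrightarrow> h t = 0" "\<And>t. 1 \<le> t \<Longrightarrow> h t = 1"
    "\<And>t. \<bar>h' t\<bar> \<le> 2"
proof -
  define p where "p = (\<lambda>t::real. (max 0 t)\<^sup>2)"
  have p: "(p has_real_derivative 2 * max 0 t) (at t)" for t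
  proof -
    consider "t < 0" | "t = 0" | "t > 0" by linarith
    then show ?thesis
    proof cases
      case 1
      have "((\<lambda>t. 0) has_real_derivative 2 * max 0 t) (at t)" using 1 by auto
      then show ?thesis
        by (rule has_field_derivative_transform_within_open[of _ _ _ "{..<0}"])
          (use 1 in \<open>auto simp: p_def\<close>)
    next
      case 2
      have "(\<lambda>h::real. max 0 h) \<midarrow>0\<rightarrow> max 0 0" by (intro tendsto_intros)
      moreover have "(p h - p 0) / h = max 0 h" for h
        by (auto simp: p_def max_def power2_eq_square)
      ultimately show ?thesis using 2 by (simp add: DERIV_def)
    next
      case 3
      have "((\<lambda>t. t\<^sup>2) has_real_derivative 2 * max 0 t) (at t)"
        using 3 by (auto intro!: derivative_eq_intros)
      then show ?thesis
        by (rule has_field_derivative_transform_within_open[of _ _ _ "{0<..}"])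
          (use 3 in \<open>auto simp: p_def\<close>)
    qed
  qed
  define h where "h t = 2 * p t - 4 * p (t - 1/2) + 2 * p (t - 1)" for t
  define h' where "h' t = 4 * max 0 t - 8 * max 0 (t - 1/2) + 4 * max 0 (t - 1)" for t :: real
  have "(h has_real_derivative h' t) (at t)" for t
    unfolding h_def[abs_def] h'_def
    by (auto intro!: derivative_eq_intros DERIV_chain2[OF p])
  moreover have "continuous_on UNIV h'" unfolding h'_def[abs_def] by (intro continuous_intros)
  moreover have "0 \<le> h t \<and> h t \<le> 1 \<and> (t \<le> 0 \<longrightarrow> h t = 0) \<and> (1 \<le> t \<longrightarrow> h t = 1) \<and> \<bar>h' t\<bar> \<le> 2" for t
  proof -
    consider "t \<le> 0" | "0 \<le> t" "t \<le> 1/2" | "1/2 \<le> t" "t \<le> 1" | "1 \<le> t" by linarith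
    then show ?thesis
    proof cases
      case 2
      then have "h t = 2 * t\<^sup>2" "t\<^sup>2 \<le> (1/2)\<^sup>2"
        by (auto simp: h_def p_def intro!: power_mono)
      with 2 show ?thesis by (auto simp: h'_def power2_eq_square max_def)
    next
      case 3
      then have e: "h t = 1 - 2 * (1 - t)\<^sup>2"
        by (simp add: h_def p_def max_def power2_eq_square algebra_simps)
      have "(1 - t)\<^sup>2 \<le> (1/2)\<^sup>2"
        using 3 by (intro power_mono) auto
      with 3 e show ?thesis by (auto simp: h'_def power2_eq_square max_def)
    qed (auto simp: h_def h'_def p_def max_def power2_eq_square algebra_simps)
  qed
  ultimately show ?thesis using that by blast
qed

text \<open>Running the step in the variable \<open>\<alpha> * ln s\<close> spreads it over the
  ratio \<open>exp (1 / \<alpha>)\<close> and makes \<open>s * q' s\<close> uniformly small. This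
  scale invariant derivative is what enters the distortion, since changing a mirror moves
  \<open>x\<close> by an amount proportional to \<open>norm x\<close>.\<close>

lemma logarithmic_cutoff:
  fixes \<alpha> :: real
  assumes "0 < \<alpha>"
  obtains q q' :: "real \<Rightarrow> real"
  where "\<And>s. (q has_real_derivative q' s) (at s)" "continuous_on UNIV q'"
    "\<And>s. 0 \<le> q s" "\<And>s. q s \<le> 1" "\<And>s. s \<le> 1 \<Longrightarrow> q s = 0" "\<And>s. exp (1 / \<alpha>) \<le> s \<Longrightarrow> q s = 1"
    "\<And>s. \<bar>s * q' s\<bar> \<le> 2 * \<alpha>"
proof -
  obtain h h' :: "real \<Rightarrow> real"
    where h: "\<And>t. (h has_real_derivative h' t) (at t)" "continuous_on UNIV h'"
      "\<And>t. 0 \<le> h t" "\<And>t. h t \<le> 1" "\<And>t. t \<le> 0 \<Longrightarrow> h t = 0" "\<And>t. 1 \<le> t \<Longrightarrow> h t = 1"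
      "\<And>t. \<bar>h' t\<bar> \<le> 2"
    using C1_smooth_step by metis
  have h'0: "h' t = 0" if "t < 0" for t
  proof -
    have "(h has_real_derivative 0) (at t)"
      by (rule has_field_derivative_transform_within_open[of "\<lambda>t. 0" _ _ "{..<0}"])
        (use that h(5) in auto)
    then show ?thesis using h(1) DERIV_unique by blast
  qed
  define q where "q s = (if s > 0 then h (\<alpha> * ln s) else 0)" for s
  define q' where "q' s = (if s > 0 then h' (\<alpha> * ln s) * (\<alpha> / s) else 0)" for s
  have q0: "q s = 0" if "s \<le> 1" for s
    using that h(5)[of "\<alpha> * ln s"] assms by (auto simp: q_def mult_le_0_iff)
  \<comment> \<open>The overlapping open sets \<open>{0<..}\<close> and \<open>{..<1}\<close> cover
    the line, and everything vanishes on the second one. Hence the singularity of \<open>ln\<close>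
    at 0 is never met.\<close>
  have q'0: "q' s = 0" if "s < 1" for s
    using that h'0[of "\<alpha> * ln s"] assms by (auto simp: q'_def mult_less_0_iff)
  have "(q has_real_derivative q' s) (at s)" for s
  proof (cases "s > 0")
    case True
    have "((\<lambda>s. \<alpha> * ln s) has_real_derivative \<alpha> / s) (at s)"
      using True by (auto intro!: derivative_eq_intros)
    from DERIV_chain2[OF h(1) this] have "((\<lambda>s. h (\<alpha> * ln s)) has_real_derivative q' s) (at s)"
      using True by (simp add: q'_def)
    then show ?thesis
      by (rule has_field_derivative_transform_within_open[of _ _ _ "{0<..}"])
        (use True in \<open>auto simp: q_def\<close>)
  next
    case False
    then have "((\<lambda>s. 0) has_real_derivative q' s) (at s)" using q'0[of s] by simp
    then show ?thesis
      by (rule has_field_derivative_transform_within_open[of _ _ _ "{..<1}"])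
        (use False q0 in auto)
  qed
  moreover have "continuous_on UNIV q'"
  proof -
    have "continuous_on {0<..} (\<lambda>s. h' (\<alpha> * ln s) * (\<alpha> / s))"
      by (intro continuous_intros continuous_on_compose2[OF h(2)]) auto
    then have "continuous_on {0<..} q'"
      by (rule continuous_on_eq) (auto simp: q'_def)
    moreover have "continuous_on {..<1} q'"
      by (rule continuous_on_eq[OF continuous_on_const[of _ 0]]) (auto simp: q'0)
    ultimately have "continuous_on ({0<..} \<union> {..<1}) q'"
      by (intro continuous_on_open_Un) auto
    moreover have "{0<..} \<union> {..<1} = (UNIV :: real set)" by auto
    ultimately show ?thesis by metis
  qed
  moreover have "q s = 1" if "exp (1 / \<alpha>) \<le> s" for s
  proof -
    have s: "s > 0" using that exp_gt_zero less_le_trans by blast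
    then have "1 / \<alpha> \<le> ln s" using that by (simp add: ln_ge_iff)
    then have "1 \<le> \<alpha> * ln s" using assms by (simp add: field_simps)
    then show ?thesis using s h(6) by (simp add: q_def)
  qed
  moreover have "\<bar>s * q' s\<bar> \<le> 2 * \<alpha>" for s
    using assms h(7)[of "\<alpha> * ln s"] by (auto simp: q'_def abs_mult)
  moreover have "0 \<le> q s" "q s \<le> 1" for s using h(3,4) by (auto simp: q_def)
  ultimately show ?thesis using q0 that by blast
qed

text \<open>The mirror varies with \<open>norm x\<close> only, which a reflection preserves, so the slowly varying
  reflection is an involution and no inverse function theorem is needed.\<close>

lemma slow_reflection_unit:
  fixes a b :: "real^'n"
  assumes a: "norm a = 1" and b: "norm b = 1" and ab: "0 \<le> a \<bullet> b"
    and r: "0 < r" and e: "0 < e" "e \<le> 1"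
  obtains H where "distorted e H"
    "\<And>x. norm x \<le> r \<Longrightarrow> H x = reflect a x"
    "\<And>x. r * exp (64 / e) \<le> norm x \<Longrightarrow> H x = reflect b x"
proof -
  \<comment> \<open>The cutoff will be evaluated at the squared norm, which is smooth at the origin;
    squaring doubles the logarithm, hence 128 here against 64 in the statement. The value also makes
    the bound \<open>ku\<close> equal to 32 * 2 * e / 128 = e / 2.\<close>
  obtain q q' :: "real \<Rightarrow> real"
    where q: "\<And>s. (q has_real_derivative q' s) (at s)" "continuous_on UNIV q'"
      "\<And>s. 0 \<le> q s" "\<And>s. q s \<le> 1" "\<And>s. s \<le> 1 \<Longrightarrow> q s = 0" "\<And>s. exp (1 / (e / 128)) \<le> s \<Longrightarrow> q s = 1"
      "\<And>s. \<bar>s * q' s\<bar> \<le> 2 * (e / 128)"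
    using logarithmic_cutoff[of "e / 128"] e by auto
  define w where "w = b - a"
  define V where "V x = a + q (x \<bullet> x / r\<^sup>2) *\<^sub>R w" for x :: "real^'n"
  define c where "c x = 2 * (x \<bullet> V x) / (V x \<bullet> V x)" for x
  define H where "H x = reflect (V x) x" for x
  \<comment> \<open>The derivative of
    \<open>(2 * (x \<bullet> v) / (v \<bullet> v)) *\<^sub>R v\<close> with respect to
    \<open>v\<close>, taken at \<open>v = V x\<close> in the direction \<open>w\<close>.\<close>
  define u where "u x = (2 * (x \<bullet> w) / (V x \<bullet> V x)
      - 4 * (x \<bullet> V x) * (V x \<bullet> w) / (V x \<bullet> V x)\<^sup>2) *\<^sub>R V x + c x *\<^sub>R w" for x
  define k where "k x h = q' (x \<bullet> x / r\<^sup>2) * (2 * (x \<bullet> h) / r\<^sup>2)" for x h :: "real^'n"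
  have aa: "a \<bullet> a = 1" "b \<bullet> b = 1" using a b by (simp_all add: dot_square_norm)
  \<comment> \<open>The normals enclose at most a right angle, so the segment from \<open>a\<close>
    to \<open>b\<close> stays away from 0 and every \<open>V x\<close> is a genuine normal.\<close>
  have VV: "1/2 \<le> V x \<bullet> V x" for x
  proof -
    define t where "t = q (x \<bullet> x / r\<^sup>2)"
    have t: "0 \<le> t" "t \<le> 1" using q(3,4) by (simp_all add: t_def)
    have "V x \<bullet> V x = 1 - 2 * t * (1 - t) * (1 - a \<bullet> b)"
      unfolding V_def w_def t_def[symmetric]
      by (simp add: inner_diff_left inner_diff_right inner_add_left inner_add_right aa
          inner_commute[of b a] algebra_simps)
    moreover have "t * (1 - t) \<le> 1/4"
      using zero_le_power2[of "t - 1/2"] by (simp add: power2_eq_square algebra_simps)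
    then have "(t * (1 - t)) * (1 - a \<bullet> b) \<le> 1/4 * 1"
      using t ab norm_cauchy_schwarz[of a b] by (intro mult_mono) (auto simp: a b)
    ultimately show ?thesis by simp
  qed
  have Vn: "V x \<bullet> V x \<noteq> 0" for x using VV[of x] by auto
  have ww: "w \<bullet> w \<le> 2"
    using ab by (simp add: w_def inner_diff_left inner_diff_right aa inner_commute)
  have wV: "norm w \<le> 2 * norm (V x)" for x
  proof (rule power2_le_imp_le)
    show "(norm w)\<^sup>2 \<le> (2 * norm (V x))\<^sup>2"
      using ww VV[of x] by (simp add: power_mult_distrib power2_norm_eq_inner)
  qed simp
  have dV: "(V has_derivative (\<lambda>h. k x h *\<^sub>R w)) (at x)" for x
  proof -
    have "((\<lambda>x::real^'n. x \<bullet> x / r\<^sup>2) has_derivative (\<lambda>h. 2 * (x \<bullet> h) / r\<^sup>2)) (at x)"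
      using r by (auto intro!: derivative_eq_intros
          simp: fun_eq_iff inner_commute field_simps power2_eq_square)
    from has_derivative_compose[OF this q(1)[unfolded has_field_derivative_def]]
    have "((\<lambda>x. q (x \<bullet> x / r\<^sup>2)) has_derivative k x) (at x)"
      unfolding k_def[abs_def] by simp
    then show ?thesis unfolding V_def[abs_def]
      by (auto intro!: derivative_eq_intros)
  qed
  have dc: "(c has_derivative (\<lambda>h. 2 * (h \<bullet> V x) / (V x \<bullet> V x) + k x h *
      (2 * (x \<bullet> w) / (V x \<bullet> V x) - 4 * (x \<bullet> V x) * (V x \<bullet> w) / (V x \<bullet> V x)\<^sup>2))) (at x)" for x
    unfolding c_def[abs_def] using Vn[of x]
    by (auto intro!: derivative_eq_intros dV ext
        simp: inner_commute[of w "V x"] field_simps power2_eq_square)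
  define H' where "H' x h = reflect (V x) h - k x h *\<^sub>R u x" for x h
  have dH: "(H has_derivative H' x) (at x)" for x
  proof -
    have "((\<lambda>x. x - c x *\<^sub>R V x) has_derivative H' x) (at x)"
      by (auto intro!: derivative_eq_intros dV dc ext
          simp: H'_def u_def reflect_def algebra_simps)
    then show ?thesis unfolding H_def[abs_def] reflect_def c_def .
  qed
  have cV: "continuous_on UNIV V"
    using dV by (meson continuous_at_imp_continuous_on has_derivative_continuous)
  have cH: "continuous_on UNIV (\<lambda>x. H' x h)" for h
    unfolding H'_def reflect_def u_def k_def c_def
    by (intro continuous_intros cV continuous_on_compose2[OF q(2)]) (use Vn r in auto)
  have inv: "H (H x) = x" for x
  proof -
    have "H x \<bullet> H x = x \<bullet> x" by (simp add: H_def dot_square_norm)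
    then have "V (H x) = V x" by (simp add: V_def)
    then show ?thesis by (simp add: H_def)
  qed
  have "C1_map H" by (rule C1_mapI[OF dH cH])
  moreover have "inv H = H" using inv by (intro inv_equality)
  moreover have "bij H" using inv by (metis bijI')
  ultimately have diff: "diffeomorphism H" unfolding diffeomorphism_def by simp
  \<comment> \<open>By \<open>wV\<close> the three terms of \<open>u x\<close> contribute at most 4,
    8 and 4 times \<open>norm x\<close>.\<close>
  have nu: "norm (u x) \<le> 16 * norm x" for x
  proof -
    define n where "n = norm (V x)"
    have n: "n > 0" "V x \<bullet> V x = n\<^sup>2" using Vn[of x] by (auto simp: n_def dot_square_norm)
    have xw: "\<bar>x \<bullet> w\<bar> \<le> norm x * (2 * n)"
      using Cauchy_Schwarz_ineq2[of x w] wV[of x] mult_left_mono[OF wV norm_ge_zero] unfolding n_def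
      by (meson order_trans)
    have xV: "\<bar>x \<bullet> V x\<bar> \<le> norm x * n" using Cauchy_Schwarz_ineq2[of x "V x"] by (simp add: n_def)
    have Vw: "\<bar>V x \<bullet> w\<bar> \<le> n * (2 * n)"
      using Cauchy_Schwarz_ineq2[of "V x" w] mult_left_mono[OF wV norm_ge_zero] unfolding n_def
      by (meson order_trans)
    have "norm ((2 * (x \<bullet> w) / (V x \<bullet> V x)) *\<^sub>R V x) \<le> 4 * norm x"
      using xw n by (simp add: n_def[symmetric] abs_mult divide_simps power2_eq_square mult_ac)
    moreover have "norm ((4 * (x \<bullet> V x) * (V x \<bullet> w) / (V x \<bullet> V x)\<^sup>2) *\<^sub>R V x) \<le> 8 * norm x"
    proof -
      have "\<bar>x \<bullet> V x\<bar> * \<bar>V x \<bullet> w\<bar> \<le> (norm x * n) * (n * (2 * n))"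
        using xV Vw n by (intro mult_mono) auto
      then show ?thesis
        using n by (simp add: n_def[symmetric] abs_mult divide_simps power2_eq_square mult_ac)
    qed
    moreover have "norm (c x *\<^sub>R w) \<le> 4 * norm x"
    proof -
      have "\<bar>x \<bullet> V x\<bar> * norm w \<le> (norm x * n) * (2 * n)"
        using xV wV[of x] n by (intro mult_mono) (auto simp: n_def)
      then show ?thesis
        using n by (simp add: c_def abs_mult divide_simps power2_eq_square mult_ac)
    qed
    ultimately show ?thesis unfolding u_def scaleR_diff_left
      by (smt (verit) norm_triangle_ineq norm_triangle_ineq4)
  qed
  have ku: "norm (k x h *\<^sub>R u x) \<le> e / 2 * norm h" for x h
  proof -
    have "\<bar>k x h\<bar> * norm (u x) \<le> (\<bar>q' (x \<bullet> x / r\<^sup>2)\<bar> * (2 * (norm x * norm h) / r\<^sup>2)) * (16 * norm x)"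
      unfolding k_def abs_mult using nu[of x] Cauchy_Schwarz_ineq2[of x h]
      by (intro mult_mono) (auto simp: abs_mult divide_right_mono)
    also have "\<dots> = 32 * \<bar>(x \<bullet> x / r\<^sup>2) * q' (x \<bullet> x / r\<^sup>2)\<bar> * norm h"
      by (simp add: abs_mult dot_square_norm power2_eq_square)
    also have "\<dots> \<le> 32 * (2 * (e / 128)) * norm h"
      by (rule mult_right_mono[OF mult_left_mono[OF q(7)]]) auto
    finally show ?thesis by simp
  qed
  have "distorted e H"
  proof (rule distortedI[OF diff dH])
    fix x h
    have le: "exp (- e) \<le> 1 - e / 2"
    proof -
      have "exp e \<ge> 1 + e" by simp
      then have "exp (- e) \<le> inverse (1 + e)" using e by (simp add: exp_minus le_imp_inverse_le)
      also have "\<dots> \<le> 1 - e / 2"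
        using e mult_left_mono[of e 1 e] by (simp add: field_simps)
      finally show ?thesis .
    qed
    have ue: "1 + e / 2 \<le> exp e" using exp_ge_add_one_self[of e] e by linarith
    have "norm h - norm (k x h *\<^sub>R u x) \<le> norm (H' x h)"
      using norm_triangle_ineq2[of "reflect (V x) h" "k x h *\<^sub>R u x"] by (simp add: H'_def)
    then have "(1 - e / 2) * norm h \<le> norm (H' x h)" using ku[of x h] by (simp add: algebra_simps)
    then show "exp (- e) * norm h \<le> norm (H' x h)"
      using mult_right_mono[OF le, of "norm h"] by simp
    have "norm (H' x h) \<le> norm h + norm (k x h *\<^sub>R u x)"
      using norm_triangle_ineq4[of "reflect (V x) h" "k x h *\<^sub>R u x"] by (simp add: H'_def)
    then have "norm (H' x h) \<le> (1 + e / 2) * norm h" using ku[of x h] by (simp add: algebra_simps)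
    then show "norm (H' x h) \<le> exp e * norm h"
      using mult_right_mono[OF ue, of "norm h"] by simp
  qed
  moreover have "H x = reflect a x" if "norm x \<le> r" for x
  proof -
    have "x \<bullet> x / r\<^sup>2 \<le> 1"
      using that r power_mono[OF that, of 2] by (simp add: dot_square_norm)
    then show ?thesis using q(5) by (simp add: H_def V_def)
  qed
  moreover have "H x = reflect b x" if "r * exp (64 / e) \<le> norm x" for x
  proof -
    have "(r * exp (64 / e))\<^sup>2 \<le> (norm x)\<^sup>2" using that r by (intro power_mono) auto
    moreover have "(exp (64 / e))\<^sup>2 = exp (1 / (e / 128))" by (simp add: exp_double[symmetric])
    ultimately have "exp (1 / (e / 128)) \<le> x \<bullet> x / r\<^sup>2"
      using r by (simp add: dot_square_norm power_mult_distrib field_simps)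
    then show ?thesis using q(6) by (simp add: H_def V_def w_def)
  qed
  ultimately show ?thesis using that by blast
qed

text \<open>A sign change of a normal does not change its reflection, so the angle may be taken at
  most a right angle. Turning the mirror of \<open>a\<close> outwards into that of \<open>b\<close>
  and composing with \<open>reflect b\<close> gives the product inside and \<open>reflect b\<close>
  twice, the identity, outside.\<close>

lemma slow_reflection_pair:
  fixes a b :: "real^'n"
  assumes ab: "a \<noteq> 0" "b \<noteq> 0" and r: "0 < r" and e: "0 < e" "e \<le> 1"
  obtains G where "distorted e G"
    "\<And>x. norm x \<le> r \<Longrightarrow> G x = reflect a (reflect b x)"
    "\<And>x. r * exp (64 / e) \<le> norm x \<Longrightarrow> G x = x"
proof -
  define s where "s = (if 0 \<le> a \<bullet> b then 1 else - 1 :: real)"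
  define a' where "a' = (s / norm a) *\<^sub>R a"
  define b' where "b' = (1 / norm b) *\<^sub>R b"
  have n: "norm a' = 1" "norm b' = 1" using ab by (auto simp: a'_def b'_def s_def)
  have i: "0 \<le> a' \<bullet> b'" using ab by (auto simp: a'_def b'_def s_def divide_simps)
  have ra: "reflect a' = reflect a"
    unfolding a'_def by (rule reflect_scaleR) (use ab in \<open>auto simp: s_def\<close>)
  have rb: "reflect b' = reflect b"
    unfolding b'_def by (rule reflect_scaleR) (use ab in auto)
  obtain H where H: "distorted e H"
    "\<And>x. norm x \<le> r \<Longrightarrow> H x = reflect a' x"
    "\<And>x. r * exp (64 / e) \<le> norm x \<Longrightarrow> H x = reflect b' x"
    using slow_reflection_unit[OF n i r e] by metis
  have "distorted 0 (reflect b)"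
    using distorted_affine_isometry[OF reflect_orthogonal_transformation, of 0 b 0] by simp
  from distorted_compose_le[OF H(1) this, of e] have "distorted e (\<lambda>x. H (reflect b x))" by simp
  then show ?thesis using that H by (simp add: ra rb)
qed

lemma orthogonal_transformation_foldr_reflect: "orthogonal_transformation (foldr reflect vs)"
proof (induction vs)
  case Nil
  then show ?case by (simp add: id_def)
next
  case (Cons v vs)
  have "foldr reflect (v # vs) = reflect v \<circ> foldr reflect vs" by auto
  then show ?case
    using orthogonal_transformation_compose[OF reflect_orthogonal_transformation Cons] by (simp add: o_def)
qed

text \<open>The mirrors are unwound in pairs, all over the same range of scales: on the inner ball
  each pair preserves the norm and outside it is the identity, so a point of either region stays
  there while the pairs are composed. Each pair costs \<open>e\<close>, which is half of what the
  bound grants.\<close>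

lemma slow_reflections:
  fixes vs :: "(real^'n) list" and r e :: real
  assumes "even (length vs)" "0 \<notin> set vs" and r: "0 < r" and e: "0 < e" "e \<le> 1"
  shows "\<exists>G. distorted (length vs * e) G \<and> (\<forall>x. norm x \<le> r \<longrightarrow> G x = foldr reflect vs x)
    \<and> (\<forall>x. r * exp (64 / e) \<le> norm x \<longrightarrow> G x = x)"
  using assms(1,2)
proof (induction vs rule: induct_list012)
  case 1
  then show ?case using distorted_id by (intro exI[of _ "\<lambda>x. x"]) auto
next
  case (3 a b vs)
  then obtain G where G: "distorted (length vs * e) G"
    "\<And>x. norm x \<le> r \<Longrightarrow> G x = foldr reflect vs x"
    "\<And>x. r * exp (64 / e) \<le> norm x \<Longrightarrow> G x = x" by auto
  have ab: "a \<noteq> 0" "b \<noteq> 0" using 3 by auto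
  obtain H where H: "distorted e H"
    "\<And>x. norm x \<le> r \<Longrightarrow> H x = reflect a (reflect b x)"
    "\<And>x. r * exp (64 / e) \<le> norm x \<Longrightarrow> H x = x"
    by (rule slow_reflection_pair[OF ab r e]) blast
  have nf: "norm (foldr reflect vs x) = norm x" for x
    using orthogonal_transformation_foldr_reflect orthogonal_transformation by blast
  show ?case
    using distorted_compose_le[OF H(1) G(1), of "length (a # b # vs) * e"] e
    by (intro exI[of _ "\<lambda>x. H (G x)"]) (auto simp: H G nf algebra_simps)
qed simp

section \<open>Moving well separated points one by one\<close>

lemma exists_orthogonal_nonzero:
  fixes S :: "(real^'n) set"
  assumes "finite S" "card S < CARD('n)"
  obtains z where "z \<noteq> 0" "\<And>x. x \<in> S \<Longrightarrow> x \<bullet> z = 0"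
proof -
  have "dim S < DIM(real^'n)"
    using dim_le_card[of S S] assms span_superset[of S] by (simp add: span_base subsetI)
  then obtain z where "z \<noteq> 0" "\<And>x. x \<in> span S \<Longrightarrow> orthogonal z x"
    using orthogonal_to_subspace_exists by blast
  then show ?thesis
    using that[of z] by (simp add: orthogonal_def inner_commute span_base)
qed

text \<open>A half turn about the midpoint of \<open>s\<close> and \<open>t\<close> that is slowly unwound.\<close>

lemma local_move:
  fixes s t :: "real^'n" and r e :: real
  assumes dim: "2 \<le> CARD('n)" and r: "0 < r" "dist s t \<le> r" and e: "0 < e" "e \<le> 1"
  obtains G f where "distorted (2 * e) G" "orthogonal_transformation f"
    "\<And>z. dist s z \<le> r \<Longrightarrow> G z = t + f (z - s)"
    "\<And>z. 3 * r * exp (64 / e) \<le> dist s z \<Longrightarrow> G z = z"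
proof (cases "s = t")
  case True
  have "distorted (2 * e) (\<lambda>z::real^'n. z)"
    by (rule distorted_mono[OF distorted_id]) (use e in simp)
  from that[OF this orthogonal_transformation_id] True show ?thesis by auto
next
  case False
  define a where "a = t - s"
  define c where "c = s + (1/2) *\<^sub>R a"
  \<comment> \<open>At least two dimensions are needed for a normal orthogonal to \<open>a\<close>.
    The two reflections then compose to a half turn of the plane of \<open>a\<close> and
    \<open>b\<close>, which sends \<open>a\<close> to \<open>- a\<close>.\<close>
  obtain b where b: "b \<noteq> 0" "a \<bullet> b = 0"
    using exists_orthogonal_nonzero[of "{a}"] dim by auto
  have a: "a \<noteq> 0" "norm a = dist s t" using False by (auto simp: a_def dist_norm norm_minus_commute)
  define f where "f = foldr reflect [a, b]"
  have f: "orthogonal_transformation f" unfolding f_def by (rule orthogonal_transformation_foldr_reflect)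
  then have lf: "linear f" by (rule orthogonal_transformation_linear)
  \<comment> \<open>Since \<open>s\<close> is within \<open>r / 2\<close> of the centre
    \<open>c\<close>, radius \<open>2 * r\<close> about \<open>c\<close> covers the ball of radius
    \<open>r\<close> about \<open>s\<close>; the factor 3 in the conclusion absorbs the same shift
    on the outside.\<close>
  obtain G where G: "distorted (2 * e) G" "\<And>x. norm x \<le> 2 * r \<Longrightarrow> G x = f x"
    "\<And>x. 2 * r * exp (64 / e) \<le> norm x \<Longrightarrow> G x = x"
    using slow_reflections[of "[a, b]" "2 * r" e] a b r e unfolding f_def by auto
  have "f ((1/2) *\<^sub>R a) = - ((1/2) *\<^sub>R a)"
    using b by (simp add: f_def reflect_eq_self reflect_self)
  then have "f (s - c) = (1/2) *\<^sub>R a" by (simp add: c_def linear_neg[OF lf])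
  moreover have "c + (1/2) *\<^sub>R a = s + (1/2 + 1/2) *\<^sub>R a"
    unfolding scaleR_add_left c_def by (simp only: add.assoc)
  ultimately have fs: "c + f (s - c) = t" by (simp add: a_def)
  have cs: "dist s c \<le> r / 2" using a r by (simp add: c_def dist_norm)
  have n: "dist s z - r / 2 \<le> norm (z - c)" "norm (z - c) \<le> dist s z + r / 2" for z
    using cs dist_triangle[of s z c] dist_triangle[of c z s]
    by (auto simp: dist_commute dist_norm norm_minus_commute)
  have "distorted (2 * e) (\<lambda>z. c + G (z - c))"
    using distorted_compose_le[OF distorted_affine_isometry[OF orthogonal_transformation_id, of c 0]
        distorted_compose_le[OF G(1) distorted_affine_isometry[OF orthogonal_transformation_id, of 0 c] order_refl],
        of "2 * e"] by simp
  moreover have "c + G (z - c) = t + f (z - s)" if "dist s z \<le> r" for z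
  proof -
    have "z - c = (z - s) + (s - c)" by simp
    then have "f (z - c) = f (z - s) + f (s - c)" by (metis linear_add[OF lf])
    moreover have "norm (z - c) \<le> 2 * r" using n[of z] that r by linarith
    ultimately show ?thesis using G(2) fs by (simp add: algebra_simps)
  qed
  moreover have "c + G (z - c) = z" if "3 * r * exp (64 / e) \<le> dist s z" for z
  proof -
    have "r * 1 \<le> r * exp (64 / e)" using r e by (intro mult_left_mono) auto
    then have "2 * r * exp (64 / e) \<le> norm (z - c)" using n[of z] that r by linarith
    then show ?thesis using G(3) by simp
  qed
  ultimately show ?thesis using that f by blast
qed

text \<open>Each move acts only within \<open>3 * r * exp (64 / e) \<le> \<sigma> / 2\<close> of its
  point, so the moves do not disturb one another. The rigid motion on the whole ball of radius
  \<open>r\<close>, beyond the value at the centre, is kept for the later insertion of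
  clusters.\<close>

lemma local_moves:
  fixes E :: "(real^'n) set" and r e :: real
  assumes dim: "2 \<le> CARD('n)" and E: "finite E" and r: "0 < r" "6 * r * exp (64 / e) \<le> \<sigma>"
    and e: "0 < e" "e \<le> 1"
    and sep: "\<And>x y. x \<in> E \<Longrightarrow> y \<in> E \<Longrightarrow> x \<noteq> y \<Longrightarrow> \<sigma> \<le> dist x y"
    and \<psi>: "\<And>x. x \<in> E \<Longrightarrow> dist x (\<psi> x) \<le> r"
  shows "\<exists>G. distorted (card E * (2 * e)) G \<and>
    (\<forall>x\<in>E. \<exists>f. orthogonal_transformation f \<and> (\<forall>z. dist x z \<le> r \<longrightarrow> G z = \<psi> x + f (z - x))) \<and>
    (\<forall>z. (\<forall>x\<in>E. \<sigma> / 2 \<le> dist x z) \<longrightarrow> G z = z)"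
  using E sep \<psi>
proof (induction E rule: finite_induct)
  case empty
  then show ?case using distorted_id by (intro exI[of _ "\<lambda>x. x"]) auto
next
  case (insert a E)
  then obtain G where G: "distorted (card E * (2 * e)) G"
    "\<forall>x\<in>E. \<exists>f. orthogonal_transformation f \<and> (\<forall>z. dist x z \<le> r \<longrightarrow> G z = \<psi> x + f (z - x))"
    "\<And>z. (\<forall>x\<in>E. \<sigma> / 2 \<le> dist x z) \<Longrightarrow> G z = z"
    by fastforce
  have "dist a (\<psi> a) \<le> r" using insert.prems by blast
  then obtain H f where H: "distorted (2 * e) H" "orthogonal_transformation f"
    "\<And>z. dist a z \<le> r \<Longrightarrow> H z = \<psi> a + f (z - a)"
    "\<And>z. 3 * r * exp (64 / e) \<le> dist a z \<Longrightarrow> H z = z"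
    using local_move[OF dim r(1) _ e, of a "\<psi> a"] by metis
  have "r * 1 \<le> r * exp (64 / e)" using r e by (intro mult_left_mono) auto
  then have r\<sigma>: "6 * r \<le> \<sigma>" using r by linarith
  have sep: "\<sigma> \<le> dist a x" if "x \<in> E" for x
    using insert.prems(1)[of a x] that insert.hyps by auto
  have "distorted (card (insert a E) * (2 * e)) (\<lambda>z. G (H z))"
    using insert.hyps e by (intro distorted_compose_le[OF G(1) H(1)]) (auto simp: algebra_simps)
  moreover have "\<exists>f. orthogonal_transformation f \<and> (\<forall>z. dist x z \<le> r \<longrightarrow> G (H z) = \<psi> x + f (z - x))"
    if "x \<in> insert a E" for x
  proof (cases "x = a")
    case True
    have "G (H z) = \<psi> a + f (z - a)" if z: "dist a z \<le> r" for z
    proof -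
      \<comment> \<open>\<open>G\<close> acts after \<open>H\<close>, so it is the image of the ball
        under \<open>H\<close> that has to avoid the other points. It stays within
        \<open>2 * r\<close> of \<open>a\<close>, and \<open>6 * r \<le> \<sigma>\<close> leaves
        \<open>\<sigma> / 2\<close>.\<close>
      have "dist (\<psi> a) (H z) \<le> r"
        using z H(3)[OF z] orthogonal_transformation_norm[OF H(2), of "z - a"]
        by (simp add: dist_norm norm_minus_commute)
      then have "dist a (H z) \<le> 2 * r"
        using \<open>dist a (\<psi> a) \<le> r\<close> dist_triangle[of a "H z" "\<psi> a"] by linarith
      then have "\<sigma> / 2 \<le> dist x (H z)" if "x \<in> E" for x
        using sep[OF that] dist_triangle[of a x "H z"] r r\<sigma> by (simp add: dist_commute)
      then show ?thesis using G(3) H(3)[OF z] by simp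
    qed
    then show ?thesis using H(2) True by blast
  next
    case False
    then have x: "x \<in> E" using that by simp
    then obtain g where g: "orthogonal_transformation g" "\<And>z. dist x z \<le> r \<Longrightarrow> G z = \<psi> x + g (z - x)"
      using G(2) by blast
    have "H z = z" if "dist x z \<le> r" for z
      using sep[OF x] dist_triangle[of a x z] that r r\<sigma> by (intro H(4)) (simp add: dist_commute)
    then show ?thesis using g by auto
  qed
  moreover have "G (H z) = z" if z: "\<forall>x\<in>insert a E. \<sigma> / 2 \<le> dist x z" for z
  proof -
    have "H z = z" using z r by (intro H(4)) auto
    then show ?thesis using G(3) z by simp
  qed
  ultimately show ?case by (intro exI[of _ "\<lambda>z. G (H z)"]) auto
qed

subsection \<open>Near isometries and clusters\<close>

text \<open>The number \<open>g * h / D\<close> is what an elimination step subtracts from a Gram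
  entry, and \<open>g / sqrt D\<close> is a component along the normalised pivot. Because the pivot
  dominates \<open>g\<close> and \<open>h\<close>, dividing by it does not amplify the error. In the
  second bound \<open>\<eta> / sqrt D\<close> is at most \<open>sqrt \<eta> / 2\<close> since
  \<open>4 * \<eta> < D\<close>; this is where the square root enters.\<close>

lemma pivot_perturbation:
  fixes D D' g g' h h' \<eta> :: real
  assumes \<eta>: "0 \<le> \<eta>" "4 * \<eta> < D" and DD: "\<bar>D - D'\<bar> \<le> \<eta>"
    and g: "\<bar>g\<bar> \<le> D" "\<bar>g - g'\<bar> \<le> \<eta>" and h: "\<bar>h\<bar> \<le> D" "\<bar>h - h'\<bar> \<le> \<eta>"
  shows "\<bar>g * h / D - g' * h' / D'\<bar> \<le> 5 * \<eta>" "\<bar>g / sqrt D - g' / sqrt D'\<bar> \<le> 2 * sqrt \<eta>"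
proof -
  have D: "0 < D" "0 < D'" using \<eta> DD by linarith+
  have g': "\<bar>g' / D'\<bar> \<le> 2"
    using D g \<eta> DD by (simp add: abs_divide pos_divide_le_eq)
  have "\<bar>g / D - g' / D'\<bar> \<le> 3 * \<eta> / D"
  proof -
    have "g / D - g' / D' = (g - g') / D + (g' / D') * ((D' - D) / D)"
      using D by (simp add: field_simps)
    also have "\<bar>\<dots>\<bar> \<le> \<bar>(g - g') / D\<bar> + \<bar>g' / D'\<bar> * \<bar>(D' - D) / D\<bar>"
      unfolding abs_mult[symmetric] by (rule abs_triangle_ineq)
    also have "\<dots> \<le> \<eta> / D + 2 * (\<eta> / D)"
      using g g' D DD \<eta> by (intro add_mono mult_mono) (auto simp: abs_divide divide_right_mono)
    finally show ?thesis by simp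
  qed
  moreover have "\<bar>h'\<bar> \<le> 5 / 4 * D" using h \<eta> by linarith
  ultimately have "\<bar>h'\<bar> * \<bar>g / D - g' / D'\<bar> \<le> (5 / 4 * D) * (3 * \<eta> / D)"
    using D by (intro mult_mono) auto
  then have "\<bar>h' * (g / D - g' / D')\<bar> \<le> 4 * \<eta>" using D \<eta> by (simp add: abs_mult)
  moreover have "\<bar>g / D * (h - h')\<bar> \<le> 1 * \<eta>"
    unfolding abs_mult using g h D by (intro mult_mono) auto
  moreover have "g * h / D - g' * h' / D' = g / D * (h - h') + h' * (g / D - g' / D')"
    by (simp add: algebra_simps diff_divide_distrib)
  moreover have "\<bar>z\<bar> \<le> 5 * \<eta>" if "\<bar>x\<bar> \<le> 4 * \<eta>" "\<bar>y\<bar> \<le> 1 * \<eta>" "z = y + x" for x y z :: real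
    using that by linarith
  ultimately show "\<bar>g * h / D - g' * h' / D'\<bar> \<le> 5 * \<eta>" by blast
  have e: "\<eta> / sqrt D \<le> sqrt \<eta> / 2"
  proof -
    have "sqrt (4 * \<eta>) \<le> sqrt D" using \<eta> by (intro real_sqrt_le_mono) auto
    then have "sqrt \<eta> * (2 * sqrt \<eta>) \<le> sqrt \<eta> * sqrt D"
      using \<eta> by (intro mult_left_mono) (auto simp: real_sqrt_mult)
    moreover have "sqrt \<eta> * (2 * sqrt \<eta>) = 2 * \<eta>" using \<eta> by simp
    ultimately have "2 * \<eta> \<le> sqrt \<eta> * sqrt D" by (simp only:)
    then show ?thesis using D by (simp add: field_simps)
  qed
  have "\<bar>sqrt D' * (sqrt D' - sqrt D)\<bar> \<le> \<eta>"
  proof -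
    have "\<bar>sqrt D' * (sqrt D' - sqrt D)\<bar> \<le> \<bar>sqrt D' + sqrt D\<bar> * \<bar>sqrt D' - sqrt D\<bar>"
      unfolding abs_mult using D by (intro mult_right_mono) auto
    also have "\<dots> = \<bar>D' - D\<bar>"
      unfolding abs_mult[symmetric] using D by (simp add: algebra_simps)
    finally show ?thesis using DD by linarith
  qed
  then have "\<bar>g' / D'\<bar> * \<bar>sqrt D' * (sqrt D' - sqrt D) / sqrt D\<bar> \<le> 2 * (\<eta> / sqrt D)"
    using g' D by (intro mult_mono) (auto simp: divide_right_mono)
  moreover have "\<bar>(g - g') / sqrt D\<bar> \<le> \<eta> / sqrt D"
    using g D by (simp add: divide_right_mono)
  moreover have "g / sqrt D - g' / sqrt D'
      = (g - g') / sqrt D + (g' / D') * (sqrt D' * (sqrt D' - sqrt D) / sqrt D)"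
  proof -
    have "g' / (S' * S') * (S' * (S' - S) / S) = g' / S' * ((S' - S) / S)" if "0 < S'" for S S'
      using that by simp
    from this[of "sqrt D'" "sqrt D"] have "(g' / D') * (sqrt D' * (sqrt D' - sqrt D) / sqrt D)
        = g' / sqrt D' * ((sqrt D' - sqrt D) / sqrt D)"
      using D by simp
    then show ?thesis using D by (simp add: field_simps)
  qed
  moreover have "\<bar>z\<bar> \<le> 3 * c" if "\<bar>x\<bar> * \<bar>y\<bar> \<le> 2 * c" "\<bar>t\<bar> \<le> c" "z = t + x * y" for x y z t c :: real
    using that abs_triangle_ineq[of t "x * y"] unfolding abs_mult by linarith
  ultimately have "\<bar>g / sqrt D - g' / sqrt D'\<bar> \<le> 3 * (\<eta> / sqrt D)" by blast
  then show "\<bar>g / sqrt D - g' / sqrt D'\<bar> \<le> 2 * sqrt \<eta>" using e \<eta> by simp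
qed

text \<open>Gram-Schmidt with pivoting: eliminating the longest vector first keeps the perturbation of
  the Gram matrix of order \<open>\<eta>\<close>.\<close>

lemma gram_close_imp_reflections:
  fixes p q :: "'i \<Rightarrow> 'a::real_inner"
  assumes "finite I" "0 \<le> \<eta>"
    and "\<And>i j. i \<in> I \<Longrightarrow> j \<in> I \<Longrightarrow> \<bar>p i \<bullet> p j - q i \<bullet> q j\<bar> \<le> \<eta>"
  shows "\<exists>vs. 0 \<notin> set vs \<and> length vs \<le> card I
    \<and> (\<forall>z. (\<forall>i\<in>I. z \<bullet> p i = 0 \<and> z \<bullet> q i = 0) \<longrightarrow> foldr reflect vs z = z)
    \<and> (\<forall>i\<in>I. norm (foldr reflect vs (p i) - q i) \<le> 5 * 4 ^ card I * sqrt \<eta>)"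
  using assms
proof (induction "card I" arbitrary: I p q \<eta>)
  case 0
  then show ?case by (intro exI[of _ "[]"]) auto
next
  case (Suc m)
  note G = Suc.prems(3)
  \<comment> \<open>With the longest vector as pivot, Cauchy-Schwarz bounds all
    \<open>p j \<bullet> p i\<close> by \<open>D\<close>, as the perturbation estimate
    requires.\<close>
  have "finite ((\<lambda>j. p j \<bullet> p j) ` I)" "(\<lambda>j. p j \<bullet> p j) ` I \<noteq> {}" using Suc by auto
  from Max_in[OF this] Max_ge[OF this(1)]
  obtain i where i: "i \<in> I" "\<And>j. j \<in> I \<Longrightarrow> p j \<bullet> p j \<le> p i \<bullet> p i"
    by (metis (no_types, lifting) imageE image_eqI)
  define D where "D = p i \<bullet> p i"
  define D' where "D' = q i \<bullet> q i"
  have np: "norm (p j) \<le> sqrt D" if "j \<in> I" for j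
    using i(2)[OF that] by (simp add: D_def norm_eq_sqrt_inner)
  have DD: "\<bar>D - D'\<bar> \<le> \<eta>" using G i by (simp add: D_def D'_def)
  show ?case
  proof (cases "D \<le> 4 * \<eta>")
    \<comment> \<open>All vectors are short, at most 2 and 3 times \<open>sqrt \<eta>\<close>, so
      the empty list will do. Their sum is the factor 5 of the bound.\<close>
    case True
    have "norm (p j - q j) \<le> 5 * 4 ^ card I * sqrt \<eta>" if j: "j \<in> I" for j
    proof -
      have "sqrt D \<le> sqrt (4 * \<eta>)" using True by simp
      then have "norm (p j) \<le> 2 * sqrt \<eta>" using np[OF j] by (simp add: real_sqrt_mult)
      moreover have "q j \<bullet> q j \<le> 9 * \<eta>" using G[OF j j] i(2)[OF j] True Suc.prems(2)
        by (simp add: D_def abs_le_iff)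
      then have "norm (q j) \<le> sqrt (9 * \<eta>)" by (simp add: norm_eq_sqrt_inner)
      then have "norm (q j) \<le> 3 * sqrt \<eta>" by (simp add: real_sqrt_mult)
      ultimately have "norm (p j - q j) \<le> 5 * 1 * sqrt \<eta>"
        using norm_triangle_ineq4[of "p j" "q j"] by simp
      also have "\<dots> \<le> 5 * 4 ^ card I * sqrt \<eta>"
        using Suc.prems(2) by (intro mult_right_mono) auto
      finally show ?thesis .
    qed
    then show ?thesis by (intro exI[of _ "[]"]) auto
  next
    case False
    then have D: "4 * \<eta> < D" "0 < D" "0 < D'" using Suc.prems(2) DD by linarith+
    define u where "u = p i /\<^sub>R sqrt D"
    define w where "w = q i /\<^sub>R sqrt D'"
    define \<rho> where "\<rho> = reflect (u - w)"
    have "norm (p i) = sqrt D" "norm (q i) = sqrt D'"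
      by (simp_all add: D_def D'_def norm_eq_sqrt_inner)
    then have nu: "norm u = 1" and nw: "norm w = 1" using D by (simp_all add: u_def w_def)
    then have \<rho>u: "\<rho> u = w" unfolding \<rho>_def by (intro reflect_swap) simp
    have ww: "w \<bullet> w = 1" using nw by (simp add: dot_square_norm)
    have \<rho>i: "\<rho> x \<bullet> \<rho> y = x \<bullet> y" for x y
      using reflect_orthogonal_transformation unfolding \<rho>_def orthogonal_transformation_def by blast
    have \<rho>w: "\<rho> x \<bullet> w = x \<bullet> u" "w \<bullet> \<rho> x = x \<bullet> u" for x
      using \<rho>i[of x u] \<rho>u by (simp_all add: inner_commute)
    define p' where "p' j = \<rho> (p j) - (p j \<bullet> u) *\<^sub>R w" for j
    define q' where "q' j = q j - (q j \<bullet> w) *\<^sub>R w" for j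
    have p'w: "w \<bullet> p' j = 0" and q'w: "w \<bullet> q' j = 0" for j
      by (simp_all add: p'_def q'_def inner_diff_right \<rho>w ww inner_commute[of w "q j"])
    have pu: "p j \<bullet> u = (p j \<bullet> p i) / sqrt D" and qw: "q j \<bullet> w = (q j \<bullet> q i) / sqrt D'" for j
      by (simp_all add: u_def w_def divide_inverse)
    have pert: "\<bar>(p j \<bullet> p i) * (p l \<bullet> p i) / D - (q j \<bullet> q i) * (q l \<bullet> q i) / D'\<bar> \<le> 5 * \<eta>"
      "\<bar>(p j \<bullet> p i) / sqrt D - (q j \<bullet> q i) / sqrt D'\<bar> \<le> 2 * sqrt \<eta>"
      if "j \<in> I" "l \<in> I" for j l
    proof -
      have b: "\<bar>p j \<bullet> p i\<bar> \<le> D" if "j \<in> I" for j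
      proof -
        have "\<bar>p j \<bullet> p i\<bar> \<le> norm (p j) * norm (p i)" by (rule Cauchy_Schwarz_ineq2)
        also have "\<dots> \<le> sqrt D * sqrt D" using np that i(1) D by (intro mult_mono) auto
        finally show ?thesis using D by simp
      qed
      note pp = pivot_perturbation[OF Suc.prems(2) D(1) DD b G b G]
      show "\<bar>(p j \<bullet> p i) * (p l \<bullet> p i) / D - (q j \<bullet> q i) * (q l \<bullet> q i) / D'\<bar> \<le> 5 * \<eta>"
        by (rule pp) (use that i in auto)
      show "\<bar>(p j \<bullet> p i) / sqrt D - (q j \<bullet> q i) / sqrt D'\<bar> \<le> 2 * sqrt \<eta>"
        by (rule pp) (use that i in auto)
    qed
    \<comment> \<open>The error grows from \<eta> to at most 6 \<eta>, rounded up to 9 \<eta> to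
      have a simple root. The bound then passes from 5 * 4^m to 15 * 4^m + 2, which is at most 5 *
      4^(m+1).\<close>
    have gram': "\<bar>p' j \<bullet> p' l - q' j \<bullet> q' l\<bar> \<le> 9 * \<eta>" if jl: "j \<in> I - {i}" "l \<in> I - {i}" for j l
    proof -
      have "p' j \<bullet> p' l = p j \<bullet> p l - (p j \<bullet> p i) * (p l \<bullet> p i) / D"
        using D by (simp add: p'_def inner_diff_left inner_diff_right \<rho>i \<rho>w ww pu)
      moreover have "q' j \<bullet> q' l = q j \<bullet> q l - (q j \<bullet> q i) * (q l \<bullet> q i) / D'"
        using D by (simp add: q'_def inner_diff_left inner_diff_right ww inner_commute[of w "q l"] qw)
      ultimately show ?thesis
        using pert(1)[of j l] G[of j l] jl Suc.prems(2) by (simp add: abs_le_iff)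
    qed
    have "card (I - {i}) = m" using Suc i by simp
    then obtain vs where vs: "0 \<notin> set vs" "length vs \<le> m"
      "\<And>z. (\<forall>j\<in>I - {i}. z \<bullet> p' j = 0 \<and> z \<bullet> q' j = 0) \<Longrightarrow> foldr reflect vs z = z"
      "\<And>j. j \<in> I - {i} \<Longrightarrow> norm (foldr reflect vs (p' j) - q' j) \<le> 5 * 4 ^ m * sqrt (9 * \<eta>)"
      using Suc.hyps(1)[of "I - {i}" "9 * \<eta>" p' q'] gram' Suc.prems by auto
    define A where "A = foldr reflect vs"
    have lA: "linear A" unfolding A_def
      using orthogonal_transformation_foldr_reflect orthogonal_transformation_linear by blast
    \<comment> \<open>If \<open>u = w\<close> no mirror is added, since the list must not contain
      0.\<close>
    define vs' where "vs' = vs @ (if u = w then [] else [u - w])"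
    have vs': "foldr reflect vs' x = A (\<rho> x)" for x
      by (simp add: vs'_def A_def \<rho>_def reflect_def)
    \<comment> \<open>The clause on vectors orthogonal to all data is carried along for this step:
      later mirrors must not spoil the pivot direction that has already been matched.\<close>
    have Aw: "A w = w" unfolding A_def
      by (rule vs(3)) (auto simp: p'w q'w)
    have "foldr reflect vs' z = z" if z: "\<forall>j\<in>I. z \<bullet> p j = 0 \<and> z \<bullet> q j = 0" for z
    proof -
      have zw: "z \<bullet> u = 0" "z \<bullet> w = 0" using z i by (simp_all add: u_def w_def)
      then have \<rho>z: "\<rho> z = z" unfolding \<rho>_def by (intro reflect_eq_self) (simp add: inner_diff_right)
      have "z \<bullet> \<rho> (p j) = 0" if "j \<in> I" for j using \<rho>i[of z "p j"] \<rho>z z that by simp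
      then have "A z = z" unfolding A_def
        using z zw by (intro vs(3)) (auto simp: p'_def q'_def inner_diff_right)
      then show ?thesis by (simp add: vs' \<rho>z)
    qed
    moreover have "norm (foldr reflect vs' (p j) - q j) \<le> 5 * 4 ^ card I * sqrt \<eta>" if j: "j \<in> I" for j
    proof -
      have "norm (A (p' j) - q' j) \<le> 15 * 4 ^ m * sqrt \<eta>"
      proof (cases "j = i")
        case True
        have "p i = sqrt D *\<^sub>R u" "q i = sqrt D' *\<^sub>R w"
          using D by (simp_all add: u_def w_def)
        moreover have "u \<bullet> u = 1" using nu by (simp add: dot_square_norm)
        moreover have "\<rho> (sqrt D *\<^sub>R u) = sqrt D *\<^sub>R w"
          using \<rho>u orthogonal_transformation_scaleR[OF reflect_orthogonal_transformation]
          unfolding \<rho>_def by metis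
        ultimately have "p' i = 0" "q' i = 0" by (simp_all add: p'_def q'_def ww)
        then show ?thesis using True linear_0[OF lA] Suc.prems(2) by simp
      next
        case False
        then show ?thesis using vs(4)[of j] j by (simp add: A_def real_sqrt_mult)
      qed
      moreover have "foldr reflect vs' (p j) - q j
        = (A (p' j) - q' j) + ((p j \<bullet> u) - (q j \<bullet> w)) *\<^sub>R w"
      proof -
        have "\<rho> (p j) = p' j + (p j \<bullet> u) *\<^sub>R w" by (simp add: p'_def)
        then have "A (\<rho> (p j)) = A (p' j) + (p j \<bullet> u) *\<^sub>R w"
          using linear_add[OF lA] linear_cmul[OF lA] Aw by metis
        then show ?thesis by (simp add: vs' q'_def algebra_simps)
      qed
      moreover have "norm (((p j \<bullet> u) - (q j \<bullet> w)) *\<^sub>R w) \<le> 2 * sqrt \<eta>"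
        using pert(2)[OF j j] by (simp add: nw pu qw)
      ultimately have "norm (foldr reflect vs' (p j) - q j) \<le> 15 * 4 ^ m * sqrt \<eta> + 2 * sqrt \<eta>"
        using norm_triangle_ineq[of "A (p' j) - q' j" "((p j \<bullet> u) - (q j \<bullet> w)) *\<^sub>R w"]
        by (simp only:)
      also have "\<dots> = (15 * 4 ^ m + 2 * 1) * sqrt \<eta>" by (simp add: algebra_simps)
      also have "\<dots> \<le> (15 * 4 ^ m + 5 * 4 ^ m) * sqrt \<eta>"
        using Suc.prems(2) by (intro mult_right_mono add_left_mono mult_mono) auto
      also have "\<dots> = 5 * 4 ^ card I * sqrt \<eta>" by (simp flip: Suc.hyps(2))
      finally show ?thesis .
    qed
    moreover have "0 \<notin> set vs'" "length vs' \<le> card I"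
      using vs(1,2) by (auto simp: vs'_def simp flip: Suc.hyps(2))
    ultimately show ?thesis by blast
  qed
qed

section \<open>Clusters\<close>

text \<open>Without an isolated cluster any pair can be enlarged to all of \<open>E\<close> in fewer
  than \<open>card E\<close> steps, so its distance controls the diameter. The distance to the
  outside is measured from every point of the cluster, so that any of them can represent it.\<close>

lemma isolated_cluster_or_comparable:
  fixes E :: "'a::metric_space set"
  assumes E: "finite E" and L: "0 \<le> L"
  obtains F where "F \<subseteq> E" "F \<noteq> E" "2 \<le> card F"
      "\<And>a b c y. a \<in> F \<Longrightarrow> b \<in> F \<Longrightarrow> c \<in> F \<Longrightarrow> y \<in> E - F \<Longrightarrow> L * dist a b \<le> dist c y"
  | "\<And>x y u v. x \<in> E \<Longrightarrow> y \<in> E \<Longrightarrow> x \<noteq> y \<Longrightarrow> u \<in> E \<Longrightarrow> v \<in> E \<Longrightarrow>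
      dist u v \<le> (1 + L) ^ card E * dist x y"
proof (cases "\<exists>F. F \<subseteq> E \<and> F \<noteq> E \<and> 2 \<le> card F \<and>
    (\<forall>a\<in>F. \<forall>b\<in>F. \<forall>c\<in>F. \<forall>y\<in>E - F. L * dist a b \<le> dist c y)")
  case True
  then show ?thesis using that(1) by blast
next
  case False
  \<comment> \<open>A set containing \<open>x\<close> and \<open>y\<close> that is not isolated absorbs a further point of \<open>E\<close>, at the cost of
    a factor \<open>1 + L\<close> in its diameter.\<close>
  have grow: "\<exists>F\<subseteq>E. card F = j \<and> x \<in> F \<and> y \<in> F \<and> (\<forall>u\<in>F. \<forall>v\<in>F. dist u v \<le> (1 + L) ^ j * dist x y)"
    if xy: "x \<in> E" "y \<in> E" "x \<noteq> y" and j: "2 \<le> j" "j \<le> card E" for x y j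
    using j
  proof (induction j rule: dec_induct)
    case base
    have "1 \<le> (1 + L)\<^sup>2" using L by (intro one_le_power) auto
    then have "dist x y \<le> (1 + L)\<^sup>2 * dist x y"
      using mult_right_mono[of 1 "(1 + L)\<^sup>2" "dist x y"] by simp
    then show ?case using xy L by (intro exI[of _ "{x, y}"]) (auto simp: dist_commute)
  next
    case (step j)
    then obtain F where F: "F \<subseteq> E" "card F = j" "x \<in> F" "y \<in> F"
      "\<And>u v. u \<in> F \<Longrightarrow> v \<in> F \<Longrightarrow> dist u v \<le> (1 + L) ^ j * dist x y" by auto
    have "F \<noteq> E" using F step.prems by auto
    with False F step.hyps obtain a b c z
      where abc: "a \<in> F" "b \<in> F" "c \<in> F" "z \<in> E - F" "dist c z < L * dist a b"
      by (metis not_le)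
    have M: "0 \<le> (1 + L) ^ j * dist x y" using L by simp
    have cz: "dist c z \<le> L * ((1 + L) ^ j * dist x y)"
      using abc F(5)[of a b] L by (meson less_imp_le mult_left_mono order_trans)
    have eq: "(1 + L) ^ Suc j * dist x y = (1 + L) ^ j * dist x y + L * ((1 + L) ^ j * dist x y)"
      by (simp add: algebra_simps)
    have zu: "dist z u \<le> (1 + L) ^ Suc j * dist x y" if "u \<in> F" for u
      using dist_triangle[of z u c] cz F(5)[OF abc(3) that] unfolding eq by (simp add: dist_commute)
    have "dist u v \<le> (1 + L) ^ Suc j * dist x y" if "u \<in> F" "v \<in> F" for u v
      using F(5)[OF that] M L unfolding eq by (smt (verit) mult_nonneg_nonneg)
    moreover have "0 \<le> (1 + L) ^ Suc j * dist x y" using L by simp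
    ultimately have "\<forall>u\<in>insert z F. \<forall>v\<in>insert z F. dist u v \<le> (1 + L) ^ Suc j * dist x y"
      using zu by (auto simp: dist_commute[of _ z] simp del: power_Suc)
    moreover have "card (insert z F) = Suc j"
      using F abc E by (metis DiffE card_insert_disjoint finite_subset)
    ultimately show ?case using F abc by (intro exI[of _ "insert z F"]) auto
  qed
  show ?thesis
  proof (rule that(2))
    fix x y u v assume a: "x \<in> E" "y \<in> E" "x \<noteq> y" "u \<in> E" "v \<in> E"
    have "card {x, y} \<le> card E" using a E by (intro card_mono) auto
    then have "2 \<le> card E" using a by simp
    from grow[OF a(1-3) this order_refl] obtain F where "F \<subseteq> E" "card F = card E"
      "\<forall>u\<in>F. \<forall>v\<in>F. dist u v \<le> (1 + L) ^ card E * dist x y" by blast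
    then show "dist u v \<le> (1 + L) ^ card E * dist x y"
      using a card_subset_eq[OF E] by metis
  qed
qed

section \<open>Near isometries and their Gram matrices\<close>

definition near_isometry_on :: "real \<Rightarrow> 'a::metric_space set \<Rightarrow> ('a \<Rightarrow> 'a) \<Rightarrow> bool" where
  "near_isometry_on \<delta> E \<phi> \<longleftrightarrow> (\<forall>x\<in>E. \<forall>y\<in>E. dist x y / (1 + \<delta>) \<le> dist (\<phi> x) (\<phi> y)
      \<and> dist (\<phi> x) (\<phi> y) \<le> (1 + \<delta>) * dist x y)"

lemma near_isometry_on_mono:
  assumes "near_isometry_on \<delta> E \<phi>" "F \<subseteq> E" "0 \<le> \<delta>" "\<delta> \<le> \<delta>'"
  shows "near_isometry_on \<delta>' F \<phi>"
  unfolding near_isometry_on_def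
proof (intro ballI conjI)
  fix x y assume "x \<in> F" "y \<in> F"
  then have *: "dist x y / (1 + \<delta>) \<le> dist (\<phi> x) (\<phi> y)" "dist (\<phi> x) (\<phi> y) \<le> (1 + \<delta>) * dist x y"
    using assms unfolding near_isometry_on_def by blast+
  have "dist x y / (1 + \<delta>') \<le> dist x y / (1 + \<delta>)" using assms by (intro divide_left_mono) auto
  then show "dist x y / (1 + \<delta>') \<le> dist (\<phi> x) (\<phi> y)" using * by linarith
  have "(1 + \<delta>) * dist x y \<le> (1 + \<delta>') * dist x y" using assms by (intro mult_right_mono) auto
  then show "dist (\<phi> x) (\<phi> y) \<le> (1 + \<delta>') * dist x y" using * by linarith
qed

lemma near_isometry_on_dist_sq:
  assumes "near_isometry_on \<delta> E \<phi>" "0 \<le> \<delta>" "\<delta> \<le> 1" "x \<in> E" "y \<in> E"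
  shows "\<bar>(dist x y)\<^sup>2 - (dist (\<phi> x) (\<phi> y))\<^sup>2\<bar> \<le> 3 * \<delta> * (dist x y)\<^sup>2"
proof -
  define a b where "a = dist x y" and "b = dist (\<phi> x) (\<phi> y)"
  have ab: "0 \<le> a" "0 \<le> b" "a / (1 + \<delta>) \<le> b" "b \<le> (1 + \<delta>) * a"
    using assms unfolding near_isometry_on_def a_def b_def by auto
  have sq: "(1 + \<delta>)\<^sup>2 \<le> 1 + 3 * \<delta>"
    using assms(2,3) mult_left_mono[of \<delta> 1 \<delta>] unfolding power2_eq_square by (simp add: algebra_simps)
  have "b\<^sup>2 \<le> ((1 + \<delta>) * a)\<^sup>2" using ab by (intro power_mono) auto
  also have "\<dots> \<le> (1 + 3 * \<delta>) * a\<^sup>2"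
    unfolding power_mult_distrib using sq by (intro mult_right_mono) auto
  finally have 1: "b\<^sup>2 \<le> a\<^sup>2 + 3 * \<delta> * a\<^sup>2" by (simp add: algebra_simps)
  have "a \<le> (1 + \<delta>) * b" using ab assms(2) by (simp add: pos_divide_le_eq mult.commute)
  then have "a\<^sup>2 \<le> ((1 + \<delta>) * b)\<^sup>2" using ab by (intro power_mono) auto
  also have "\<dots> \<le> (1 + 3 * \<delta>) * b\<^sup>2"
    unfolding power_mult_distrib using sq by (intro mult_right_mono) auto
  finally have 2: "a\<^sup>2 \<le> b\<^sup>2 + 3 * \<delta> * b\<^sup>2" by (simp add: algebra_simps)
  have "a\<^sup>2 - b\<^sup>2 \<le> 3 * \<delta> * a\<^sup>2"
  proof (cases "b\<^sup>2 \<le> a\<^sup>2")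
    case True
    then have "3 * \<delta> * b\<^sup>2 \<le> 3 * \<delta> * a\<^sup>2" using assms(2) by (intro mult_left_mono) auto
    then show ?thesis using 2 by linarith
  next
    case False
    moreover have "0 \<le> 3 * \<delta> * a\<^sup>2" using assms(2) by simp
    ultimately show ?thesis by linarith
  qed
  then show ?thesis using 1 unfolding a_def b_def by linarith
qed

text \<open>Polarisation expresses the inner product by three squared distances, of which two are at
  most \<open>d\<^sup>2\<close> and one at most \<open>4 * d\<^sup>2\<close>; half of 3 \<delta>
  times 6 gives the constant 9.\<close>

lemma near_isometry_on_gram:
  fixes \<phi> :: "'a::real_inner \<Rightarrow> 'a"
  assumes \<phi>: "near_isometry_on \<delta> E \<phi>" "0 \<le> \<delta>" "\<delta> \<le> 1"
    and x0: "x0 \<in> E" and d: "\<And>x. x \<in> E \<Longrightarrow> dist x0 x \<le> d" and xy: "x \<in> E" "y \<in> E"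
  shows "\<bar>(x - x0) \<bullet> (y - x0) - (\<phi> x - \<phi> x0) \<bullet> (\<phi> y - \<phi> x0)\<bar> \<le> 9 * \<delta> * d\<^sup>2"
proof -
  have pol: "2 * ((u - c) \<bullet> (v - c)) = (dist c u)\<^sup>2 + (dist c v)\<^sup>2 - (dist u v)\<^sup>2" for u v c :: 'a
    by (simp add: dist_norm power2_norm_eq_inner inner_diff_left inner_diff_right inner_commute)
  have "(dist x0 x)\<^sup>2 \<le> d\<^sup>2" "(dist x0 y)\<^sup>2 \<le> d\<^sup>2" using d xy by (auto intro!: power_mono)
  moreover have "dist x y \<le> 2 * d"
    using d[OF xy(1)] d[OF xy(2)] dist_triangle3[of x y x0] by linarith
  then have "(dist x y)\<^sup>2 \<le> (2 * d)\<^sup>2" by (intro power_mono) auto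
  ultimately have *: "\<delta> * (dist x0 x)\<^sup>2 \<le> \<delta> * d\<^sup>2" "\<delta> * (dist x0 y)\<^sup>2 \<le> \<delta> * d\<^sup>2"
    "\<delta> * (dist x y)\<^sup>2 \<le> \<delta> * (4 * d\<^sup>2)"
    using \<phi>(2) by (auto intro!: mult_left_mono)
  show ?thesis
    using near_isometry_on_dist_sq[OF \<phi> x0 xy(1)] near_isometry_on_dist_sq[OF \<phi> x0 xy(2)]
      near_isometry_on_dist_sq[OF \<phi> xy] * pol[of x x0 y] pol[of "\<phi> x" "\<phi> x0" "\<phi> y"]
    unfolding abs_le_iff by (simp add: algebra_simps)
qed

text \<open>The induction carries more than an extension: \<open>\<Phi>\<close> is the identity far away from \<open>E\<close> (when there
  is room to choose the orientation) and a rigid motion near every point of \<open>E\<close>, so that a point can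
  later be replaced by a cluster.\<close>

definition controlled_extension ::
  "real \<Rightarrow> real \<Rightarrow> (real^'n) set \<Rightarrow> real^'n \<Rightarrow> (real^'n \<Rightarrow> real^'n) \<Rightarrow> (real^'n \<Rightarrow> real^'n) \<Rightarrow> bool" where
  "controlled_extension \<epsilon> R E x0 \<phi> \<Phi> \<longleftrightarrow> distorted \<epsilon> \<Phi> \<and> (\<forall>x\<in>E. \<Phi> x = \<phi> x)
    \<and> (card E \<le> CARD('n) \<longrightarrow> (\<forall>z. (\<forall>x\<in>E. R * dist x0 x \<le> dist x0 z) \<longrightarrow> \<Phi> z = z))
    \<and> (\<forall>x\<in>E. \<exists>f. orthogonal_transformation f \<and>
        (\<forall>z. (\<forall>y\<in>E - {x}. R * dist x z \<le> dist x y) \<longrightarrow> \<Phi> z = \<phi> x + f (z - x)))"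

lemma controlled_extensionD:
  fixes E :: "(real^'n) set"
  assumes "controlled_extension \<epsilon> R E x0 \<phi> \<Phi>"
  shows "distorted \<epsilon> \<Phi>" "\<And>x. x \<in> E \<Longrightarrow> \<Phi> x = \<phi> x"
    "\<And>z. card E \<le> CARD('n) \<Longrightarrow> (\<And>x. x \<in> E \<Longrightarrow> R * dist x0 x \<le> dist x0 z) \<Longrightarrow> \<Phi> z = z"
    "\<And>x. x \<in> E \<Longrightarrow> \<exists>f. orthogonal_transformation f \<and>
        (\<forall>z. (\<forall>y\<in>E - {x}. R * dist x z \<le> dist x y) \<longrightarrow> \<Phi> z = \<phi> x + f (z - x))"
  using assms unfolding controlled_extension_def by blast+

lemma orthogonal_transformation_inv_simps:
  fixes f :: "'a::euclidean_space \<Rightarrow> 'a"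
  assumes "orthogonal_transformation f"
  shows "f (inv f y) = y" "inv f (f y) = y" "norm (f x) = norm x" "norm (inv f x) = norm x"
    "f (x + y) = f x + f y" "f (x - y) = f x - f y" "inv f (x - y) = inv f x - inv f y"
proof -
  have bij: "bij f" using assms by (rule orthogonal_transformation_bij)
  have i: "orthogonal_transformation (inv f)" using assms by (rule orthogonal_transformation_inv)
  show "f (inv f y) = y" "inv f (f y) = y"
    using bij by (simp_all add: bij_is_inj bij_is_surj surj_f_inv_f)
  show "norm (f x) = norm x" "norm (inv f x) = norm x"
    using assms i orthogonal_transformation by blast+
  show "f (x + y) = f x + f y" "f (x - y) = f x - f y" "inv f (x - y) = inv f x - inv f y"
    using assms i orthogonal_transformation_linear linear_add linear_diff by blast+
qed

section \<open>The two induction steps\<close>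

text \<open>The extension is \<open>\<Phi>1 \<circ> \<Phi>2\<close>, where \<open>\<Phi>2\<close>
  rearranges the cluster inside the region on which \<open>\<Phi>1\<close> is rigid. One factor
  \<open>R\<close> of the isolation makes room for \<open>\<Phi>2\<close> to become the identity,
  the other one for \<open>\<Phi>1\<close> to be rigid. Both \<open>F\<close> and the collapsed set
  have at most \<open>CARD('n)\<close> points, so the clause on the identity far away is available
  for each.\<close>

lemma controlled_extension_cluster:
  fixes \<phi> :: "real^'n \<Rightarrow> real^'n"
  assumes E: "finite E" "card E \<le> CARD('n) + 1" and x0: "x0 \<in> E" "\<phi> x0 = x0"
    and near: "near_isometry_on \<delta> E \<phi>"
    and IH: "\<And>(E' :: (real^'n) set) x0 \<phi>. finite E' \<Longrightarrow> card E' < card E \<Longrightarrow> x0 \<in> E' \<Longrightarrow> \<phi> x0 = x0 \<Longrightarrow>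
      near_isometry_on \<delta> E' \<phi> \<Longrightarrow> \<exists>\<Phi>. controlled_extension (\<epsilon> / 2) R E' x0 \<phi> \<Phi>"
    and F: "F \<subseteq> E" "F \<noteq> E" "2 \<le> card F"
    and iso: "\<And>a b c y. a \<in> F \<Longrightarrow> b \<in> F \<Longrightarrow> c \<in> F \<Longrightarrow> y \<in> E - F \<Longrightarrow> R\<^sup>2 * dist a b \<le> dist c y"
    and R: "2 \<le> R" "4 * R \<le> R'" and \<delta>: "0 \<le> \<delta>"
  shows "\<exists>\<Phi>. controlled_extension \<epsilon> R' E x0 \<phi> \<Phi>"
proof -
  have finF: "finite F" using F E finite_subset by blast
  \<comment> \<open>The representative is \<open>x0\<close> whenever possible, so that the base
    point survives the collapse.\<close>
  obtain s where s: "s \<in> F" "x0 \<in> F \<Longrightarrow> s = x0"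
    using F by (cases "x0 \<in> F") (force, metis all_not_in_conv card.empty not_numeral_le_zero)
  have "F \<noteq> {s}" using F(3) by auto
  then obtain b where b: "b \<in> F" "b \<noteq> s" using s by blast
  define E' where "E' = insert s (E - F)"
  have E'E: "E' \<subseteq> E" using s F by (auto simp: E'_def)
  have bE': "b \<notin> E'" using b by (auto simp: E'_def)
  have cE': "card E' < card E"
    by (rule psubset_card_mono) (use E E'E b F bE' in auto)
  have cF: "card F < card E" by (rule psubset_card_mono) (use E F in auto)
  have x0E': "x0 \<in> E'" using s x0 by (auto simp: E'_def)
  have nE': "near_isometry_on \<delta> E' \<phi>" using near_isometry_on_mono[OF near E'E \<delta>] by simp
  obtain \<Phi>1 where \<Phi>1: "controlled_extension (\<epsilon> / 2) R E' x0 \<phi> \<Phi>1"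
    using IH[of E' x0 \<phi>, OF _ cE' x0E' x0(2) nE'] E'E E(1) finite_subset by blast
  have "card E' \<le> CARD('n)" using cE' E(2) by simp
  note d1 = controlled_extensionD(1)[OF \<Phi>1] and e1 = controlled_extensionD(2)[OF \<Phi>1]
    and o1 = controlled_extensionD(3)[OF \<Phi>1 this] and r1 = controlled_extensionD(4)[OF \<Phi>1]
  have sE': "s \<in> E'" "E' - {s} = E - F" using s by (auto simp: E'_def)
  obtain f where f: "orthogonal_transformation f"
    and rf: "\<And>z. (\<And>y. y \<in> E - F \<Longrightarrow> R * dist s z \<le> dist s y) \<Longrightarrow> \<Phi>1 z = \<phi> s + f (z - s)"
    using r1[OF sE'(1)] unfolding sE'(2) by blast
  note fs = orthogonal_transformation_inv_simps[OF f]
  \<comment> \<open>The values of \<open>\<phi>\<close> on \<open>F\<close> are pulled back by the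
    rigid motion that \<open>\<Phi>1\<close> is near \<open>s\<close>.\<close>
  define \<psi> where "\<psi> x = s + inv f (\<phi> x - \<phi> s)" for x
  have "inv f 0 = 0" using fs(4)[of 0] by simp
  then have \<psi>s: "\<psi> s = s" by (simp add: \<psi>_def)
  have "dist (\<psi> x) (\<psi> y) = dist (\<phi> x) (\<phi> y)" for x y
    unfolding \<psi>_def dist_norm by (simp add: fs flip: fs(7))
  then have "near_isometry_on \<delta> F \<psi>"
    using near F(1) unfolding near_isometry_on_def by (metis subsetD)
  then obtain \<Phi>2 where \<Phi>2: "controlled_extension (\<epsilon> / 2) R F s \<psi> \<Phi>2"
    using IH[of F s \<psi>, OF finF cF s(1) \<psi>s] by blast
  have "card F \<le> CARD('n)" using cF E(2) by simp
  note d2 = controlled_extensionD(1)[OF \<Phi>2] and e2 = controlled_extensionD(2)[OF \<Phi>2]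
    and o2 = controlled_extensionD(3)[OF \<Phi>2 this] and r2 = controlled_extensionD(4)[OF \<Phi>2]
  define U where "U = {z. \<forall>x\<in>F. R * dist s x \<le> dist s z}"
  have U: "\<Phi>2 z = z" if "z \<in> U" for z using that o2 unfolding U_def by blast
  \<comment> \<open>An injective map that fixes \<open>U\<close> pointwise preserves the complement
    of \<open>U\<close>; hence \<open>\<Phi>1\<close> is still rigid at the points moved by
    \<open>\<Phi>2\<close>.\<close>
  have notU: "\<Phi>2 z \<notin> U" if "z \<notin> U" for z
    using that U[of "\<Phi>2 z"] injD[OF bij_is_inj[OF distorted_bij[OF d2]], of "\<Phi>2 z" z] by metis
  have rigid: "\<Phi>1 z = \<phi> s + f (z - s)" if z: "z \<notin> U" for z
  proof (rule rf)
    fix y assume y: "y \<in> E - F"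
    obtain x where x: "x \<in> F" "dist s z < R * dist s x" using z by (auto simp: U_def not_le)
    then have "R * dist s z \<le> R * (R * dist s x)" using R by (intro mult_left_mono) auto
    also have "\<dots> \<le> dist s y" using iso[OF s(1) x(1) s(1) y] by (simp add: power2_eq_square)
    finally show "R * dist s z \<le> dist s y" .
  qed
  have FU: "x \<notin> U" if "x \<in> F" for x
  proof
    assume "x \<in> U"
    then have "R * dist s x \<le> dist s x" "R * dist s b \<le> dist s x" using that b by (auto simp: U_def)
    moreover have "2 * dist s x \<le> R * dist s x" "2 * dist s b \<le> R * dist s b"
      using R by (auto intro!: mult_right_mono)
    ultimately have "dist s b \<le> 0" by (smt (verit) zero_le_dist)
    then show False using b by simp
  qed
  \<comment> \<open>One of the two factors \<open>R\<close> is traded for 2: then every point at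
    least half as far from \<open>s\<close> as a point of \<open>E - F\<close> lies in
    \<open>U\<close>.\<close>
  have far: "2 * (R * dist s x) \<le> dist s y" if "x \<in> F" "y \<in> E - F" for x y
  proof -
    have "2 * (R * dist s x) \<le> R * (R * dist s x)" using R by (intro mult_right_mono) auto
    then show ?thesis using iso[OF s(1) that(1) s(1) that(2)] by (simp add: power2_eq_square)
  qed
  have R'le: "2 * dist a c \<le> R' * dist a c" "R * dist a c \<le> R' * dist a c" for a c :: "real^'n"
    using R by (auto intro!: mult_right_mono)
  define \<Phi> where "\<Phi> z = \<Phi>1 (\<Phi>2 z)" for z
  have "distorted \<epsilon> \<Phi>"
    unfolding \<Phi>_def[abs_def] using distorted_compose_le[OF d1 d2] by simp
  moreover have "\<Phi> x = \<phi> x" if "x \<in> E" for x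
  proof (cases "x \<in> F")
    case True
    then show ?thesis using rigid[OF notU[OF FU]] e2 by (simp add: \<Phi>_def \<psi>_def fs)
  next
    case False
    then have x: "x \<in> E - F" using that by simp
    then have "x \<in> U" using far[OF _ x] R by (smt (verit) U_def mem_Collect_eq mult_nonneg_nonneg zero_le_dist)
    then show ?thesis using U e1 x by (simp add: \<Phi>_def E'_def)
  qed
  moreover have "\<Phi> z = z" if z: "\<And>x. x \<in> E \<Longrightarrow> R' * dist x0 x \<le> dist x0 z" for z
  proof -
    have "R * dist s x \<le> dist s z" if x: "x \<in> F" for x
    proof -
      have "4 * (R * dist x0 y) \<le> dist x0 z" if "y \<in> E" for y
        using z[OF that] mult_right_mono[OF R(2), of "dist x0 y"] by simp
      then have *: "4 * (R * dist x0 x) \<le> dist x0 z" "4 * (R * dist x0 s) \<le> dist x0 z"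
        using x s F by auto
      have "R * dist s x \<le> R * (dist x0 s + dist x0 x)"
        using R dist_triangle3[of s x x0] by (intro mult_left_mono) auto
      also have "\<dots> \<le> dist x0 z / 2" using * by (simp add: algebra_simps)
      also have "\<dots> \<le> dist s z"
      proof -
        have "2 * dist x0 s \<le> R * dist x0 s" using R by (intro mult_right_mono) auto
        then show ?thesis using * dist_triangle[of x0 z s] zero_le_dist[of x0 s] by linarith
      qed
      finally show ?thesis .
    qed
    then have "\<Phi>2 z = z" by (rule o2)
    moreover have "\<Phi>1 z = z"
      using z E'E R'le(2) by (intro o1) (meson order_trans subsetD)
    ultimately show ?thesis by (simp add: \<Phi>_def)
  qed
  moreover have "\<exists>g. orthogonal_transformation g \<and>
        (\<forall>z. (\<forall>y\<in>E - {x}. R' * dist x z \<le> dist x y) \<longrightarrow> \<Phi> z = \<phi> x + g (z - x))" if x: "x \<in> E" for x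
  proof (cases "x \<in> F")
    case True
    obtain g where g: "orthogonal_transformation g"
      "\<And>z. (\<And>y. y \<in> F - {x} \<Longrightarrow> R * dist x z \<le> dist x y) \<Longrightarrow> \<Phi>2 z = \<psi> x + g (z - x)"
      using r2[OF True] by blast
    have "\<Phi> z = \<phi> x + f (g (z - x))" if z: "\<forall>y\<in>E - {x}. R' * dist x z \<le> dist x y" for z
    proof -
      have 2: "\<Phi>2 z = \<psi> x + g (z - x)"
        using z F(1) R'le(2) by (intro g(2)) (meson Diff_iff order_trans subsetD)
      have "z \<notin> U"
      proof
        assume zU: "z \<in> U"
        \<comment> \<open>A second point of the cluster: \<open>z\<close> is close to
          \<open>x\<close> on the scale of \<open>dist x y\<close>, whereas points of
          \<open>U\<close> are far from \<open>s\<close> on the scale of the whole cluster.\<close>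
        define y where "y = (if x = s then b else s)"
        have y: "y \<in> F" "y \<noteq> x" using b s by (auto simp: y_def)
        then have "2 * dist x z \<le> dist x y" using z F(1) R'le(1)[of x z] by force
        moreover have "2 * dist s y' \<le> dist s z" if "y' \<in> F" for y'
          using zU that mult_right_mono[OF R(1), of "dist s y'"] by (force simp: U_def)
        then have "2 * dist s x \<le> dist s z" "2 * dist s y \<le> dist s z" using True y by auto
        moreover have "0 < dist x y" using y by simp
        moreover have "(x = s \<and> dist x y = dist s y \<and> dist x z = dist s z) \<or> dist x y = dist s x"
          by (simp add: y_def dist_commute)
        ultimately show False using dist_triangle[of s z x] by linarith
      qed
      from rigid[OF notU[OF this]] have "\<Phi> z = \<phi> s + f (\<Phi>2 z - s)" by (simp add: \<Phi>_def)
      moreover have "\<Phi>2 z - s = inv f (\<phi> x - \<phi> s) + g (z - x)" using 2 by (simp add: \<psi>_def)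
      ultimately show ?thesis by (simp only: fs(1,5)) simp
    qed
    moreover have "orthogonal_transformation (\<lambda>v. f (g v))"
      using orthogonal_transformation_compose[OF f g(1)] by (simp add: o_def)
    ultimately show ?thesis by (intro exI[of _ "\<lambda>v. f (g v)"]) auto
  next
    case False
    then have x': "x \<in> E - F" "x \<in> E'" using x by (auto simp: E'_def)
    obtain g where g: "orthogonal_transformation g"
      "\<And>z. (\<And>y. y \<in> E' - {x} \<Longrightarrow> R * dist x z \<le> dist x y) \<Longrightarrow> \<Phi>1 z = \<phi> x + g (z - x)"
      using r1[OF x'(2)] by blast
    have "\<Phi> z = \<phi> x + g (z - x)" if z: "\<forall>y\<in>E - {x}. R' * dist x z \<le> dist x y" for z
    proof -
      have "s \<in> E - {x}" using s F False by auto
      then have "2 * dist x z \<le> dist x s" using z R'le(1)[of x z] by force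
      then have "dist s x / 2 \<le> dist s z" using dist_triangle[of s x z] by (simp add: dist_commute)
      then have "R * dist s y \<le> dist s z" if "y \<in> F" for y using far[OF that x'(1)] by linarith
      then have "\<Phi>2 z = z" by (rule o2)
      moreover have "\<Phi>1 z = \<phi> x + g (z - x)"
        using z E'E R'le(2) by (intro g(2)) (meson Diff_iff order_trans subsetD)
      ultimately show ?thesis by (simp add: \<Phi>_def)
    qed
    then show ?thesis using g(1) by blast
  qed
  ultimately show ?thesis unfolding controlled_extension_def by blast
qed

text \<open>Gram matrices based at \<open>x0\<close> differ by at most
  \<open>9 * \<delta> * d\<^sup>2\<close>, and the root of this,
  \<open>3 * sqrt \<delta> * d\<close>, gives the constant 15. The length allows
  \<open>card E\<close> mirrors and one more for the parity.\<close>

lemma near_isometry_on_imp_reflections: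
  fixes \<phi> :: "real^'n \<Rightarrow> real^'n"
  assumes E: "finite E" "card E \<le> CARD('n) + 1" and x0: "x0 \<in> E"
    and near: "near_isometry_on \<delta> E \<phi>" "0 \<le> \<delta>" "\<delta> \<le> 1"
    and d: "\<And>x. x \<in> E \<Longrightarrow> dist x0 x \<le> d" "0 \<le> d"
  obtains vs :: "(real^'n) list" where "0 \<notin> set vs" "length vs \<le> CARD('n) + 2"
    "card E \<le> CARD('n) \<Longrightarrow> even (length vs)"
    "\<And>x. x \<in> E \<Longrightarrow> norm (foldr reflect vs (x - x0) - (\<phi> x - \<phi> x0))
      \<le> 15 * 4 ^ (CARD('n) + 1) * sqrt \<delta> * d"
proof -
  obtain vs :: "(real^'n) list" where vs: "0 \<notin> set vs" "length vs \<le> card E"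
    "\<And>x. x \<in> E \<Longrightarrow> norm (foldr reflect vs (x - x0) - (\<phi> x - \<phi> x0))
      \<le> 5 * 4 ^ card E * sqrt (9 * \<delta> * d\<^sup>2)"
    using gram_close_imp_reflections[OF E(1), of "9 * \<delta> * d\<^sup>2" "\<lambda>x. x - x0" "\<lambda>x. \<phi> x - \<phi> x0"]
      near_isometry_on_gram[OF near x0 d(1)] near(2) by auto
  have "sqrt (9 * \<delta> * d\<^sup>2) = 3 * sqrt \<delta> * d" using d(2) by (simp add: real_sqrt_mult)
  moreover have "(4::real) ^ card E \<le> 4 ^ (CARD('n) + 1)" using E(2) by (intro power_increasing) auto
  then have "5 * 4 ^ card E * (3 * sqrt \<delta> * d) \<le> 5 * 4 ^ (CARD('n) + 1) * (3 * sqrt \<delta> * d)"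
    using near(2) d(2) by (intro mult_right_mono mult_left_mono) auto
  ultimately have err: "norm (foldr reflect vs (x - x0) - (\<phi> x - \<phi> x0))
      \<le> 15 * 4 ^ (CARD('n) + 1) * sqrt \<delta> * d" if "x \<in> E" for x
    using vs(3)[OF that] by (simp only:)
  show thesis
  proof (cases "card E \<le> CARD('n) \<longrightarrow> even (length vs)")
    case True
    then show ?thesis using that[of vs] vs err E(2) by auto
  next
    case False
    \<comment> \<open>The points of \<open>E\<close> lie in a hyperplane, whose reflection corrects the parity.\<close>
    then have "card ((\<lambda>x. x - x0) ` (E - {x0})) < CARD('n)"
      using card_image_le[of "E - {x0}" "\<lambda>x. x - x0"] E(1) x0 card_gt_0_iff[of E] by fastforce
    then obtain n where n: "n \<noteq> 0" "\<And>x. x \<in> (\<lambda>x. x - x0) ` (E - {x0}) \<Longrightarrow> x \<bullet> n = 0"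
      using exists_orthogonal_nonzero[of "(\<lambda>x. x - x0) ` (E - {x0})"] E(1) by blast
    have "(x - x0) \<bullet> n = 0" if "x \<in> E" for x
      using n(2)[of "x - x0"] that by (cases "x = x0") auto
    \<comment> \<open>The extra mirror stands last in the list and therefore acts first, on vectors
      that it fixes.\<close>
    then have "foldr reflect (vs @ [n]) (x - x0) = foldr reflect vs (x - x0)" if "x \<in> E" for x
      using that by (simp add: reflect_eq_self)
    then show ?thesis using that[of "vs @ [n]"] vs(1,2) n(1) err False E(2) by simp
  qed
qed

text \<open>\<open>G\<close> corrects the points before the reflections are applied: it sends
  \<open>x\<close> to the point \<open>\<psi> x\<close> that the rigid motion with linear part
  \<open>A\<close> takes exactly to \<open>\<phi> x\<close>. \<open>H\<close> agrees with
  \<open>A\<close> on a ball containing all the corrected points and, if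
  \<open>card E \<le> CARD('n)\<close>, unwinds it further out.\<close>

lemma controlled_extension_comparable:
  fixes \<phi> :: "real^'n \<Rightarrow> real^'n"
  assumes dim: "2 \<le> CARD('n)" and E: "finite E" "card E \<le> CARD('n) + 1" "2 \<le> card E"
    and x0: "x0 \<in> E" "\<phi> x0 = x0"
    and \<epsilon>: "0 < \<epsilon>" "\<epsilon> \<le> 1" and near: "near_isometry_on \<delta> E \<phi>" "0 \<le> \<delta>" "\<delta> \<le> 1"
    and comparable: "\<And>x y u v. x \<in> E \<Longrightarrow> y \<in> E \<Longrightarrow> x \<noteq> y \<Longrightarrow> u \<in> E \<Longrightarrow> v \<in> E \<Longrightarrow> dist u v \<le> \<Lambda> * dist x y"
    and T: "T = exp (256 * (CARD('n) + 1) / \<epsilon>)" and \<Lambda>: "1 \<le> \<Lambda>"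
    and R: "12 * T * \<Lambda> \<le> R" and small: "90 * 4 ^ (CARD('n) + 1) * T * \<Lambda> * sqrt \<delta> \<le> 1"
  shows "\<exists>\<Phi>. controlled_extension \<epsilon> R E x0 \<phi> \<Phi>"
proof -
  define N where "N = real (CARD('n) + 1)"
  \<comment> \<open>The corrections cost at most \<open>2 * N * e\<close> and the unwinding at most
    \<open>(N + 1) * e\<close>, in total at most \<open>4 * N * e\<close>, which is
    \<epsilon>.\<close>
  define e where "e = \<epsilon> / (4 * N)"
  have N: "1 \<le> N" by (simp add: N_def)
  have e: "0 < e" "e \<le> 1" using \<epsilon> N by (auto simp: e_def)
  have T': "T = exp (64 / e)" using T \<epsilon> by (simp add: e_def N_def)
  have T1: "1 \<le> T" using e by (simp add: T')
  obtain d where d: "\<And>x. x \<in> E \<Longrightarrow> dist x0 x \<le> d" "d \<in> dist x0 ` E"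
    using Max_ge[of "dist x0 ` E"] Max_in[of "dist x0 ` E"] E(1) x0(1) by blast
  have other: "\<exists>y\<in>E. y \<noteq> x" for x
  proof (rule ccontr)
    assume "\<not> (\<exists>y\<in>E. y \<noteq> x)"
    then have "E \<subseteq> {x}" by blast
    then show False using card_mono[of "{x}" E] E(3) by simp
  qed
  have dpos: "0 < d" using other[of x0] d(1) by (metis less_le_trans zero_less_dist_iff)
  define \<sigma> where "\<sigma> = d / \<Lambda>"
  have sep: "\<sigma> \<le> dist x y" if "x \<in> E" "y \<in> E" "x \<noteq> y" for x y
    using comparable[OF that x0(1)] d(2) \<Lambda> by (auto simp: \<sigma>_def pos_divide_le_eq mult.commute)
  have \<sigma>d: "0 < \<sigma>" "\<sigma> \<le> d" using dpos \<Lambda> by (auto simp: \<sigma>_def pos_divide_le_eq)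
  \<comment> \<open>The largest radius that \<open>local_moves\<close> admits at separation
    \<open>\<sigma>\<close>. As \<open>r\<close> is \<open>d / (6 * T * \<Lambda>)\<close>,
    \<open>small\<close> bounds the error of the reflections by \<open>r\<close> (90 is 15 * 6), and
    \<open>12 * T * \<Lambda> \<le> R\<close> ensures that points \<open>R\<close> times closer to
    \<open>x\<close> than the other points of \<open>E\<close> lie within \<open>r\<close>.\<close>
  define r where "r = \<sigma> / (6 * T)"
  have r: "0 < r" "6 * r * exp (64 / e) \<le> \<sigma>" using \<sigma>d T1 by (auto simp: r_def T')
  have rd: "2 * r \<le> d"
  proof -
    have "r * 1 \<le> r * exp (64 / e)" using r e by (intro mult_left_mono) auto
    then show ?thesis using r \<sigma>d by linarith
  qed
  obtain vs :: "(real^'n) list" where vs: "0 \<notin> set vs" "length vs \<le> CARD('n) + 2"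
    "card E \<le> CARD('n) \<Longrightarrow> even (length vs)"
    "\<And>x. x \<in> E \<Longrightarrow> norm (foldr reflect vs (x - x0) - (\<phi> x - \<phi> x0))
      \<le> 15 * 4 ^ (CARD('n) + 1) * sqrt \<delta> * d"
    using near_isometry_on_imp_reflections[OF E(1,2) x0(1) near d(1)] dpos by (metis less_imp_le)
  define A where "A = foldr reflect vs"
  have A: "orthogonal_transformation A"
    unfolding A_def by (rule orthogonal_transformation_foldr_reflect)
  note As = orthogonal_transformation_inv_simps[OF A]
  define \<psi> where "\<psi> x = x0 + inv A (\<phi> x - \<phi> x0)" for x
  have \<psi>: "dist x (\<psi> x) \<le> r" if "x \<in> E" for x
  proof -
    have "dist x (\<psi> x) = norm (A (x - \<psi> x))" by (simp only: As(3) dist_norm)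
    also have "A (x - \<psi> x) = A ((x - x0) - inv A (\<phi> x - \<phi> x0))"
      by (simp add: \<psi>_def algebra_simps)
    also have "\<dots> = A (x - x0) - (\<phi> x - \<phi> x0)" by (simp only: As(1,6))
    also have "norm \<dots> \<le> 15 * 4 ^ (CARD('n) + 1) * sqrt \<delta> * d" using vs(4)[OF that] by (simp add: A_def)
    also have "\<dots> \<le> r"
    proof -
      have "(90 * 4 ^ (CARD('n) + 1) * T * \<Lambda> * sqrt \<delta>) * d \<le> 1 * d"
        using small dpos by (intro mult_right_mono) auto
      then show ?thesis using T1 \<Lambda> by (simp add: r_def \<sigma>_def field_simps)
    qed
    finally show ?thesis .
  qed
  obtain G where G: "distorted (card E * (2 * e)) G"
    "\<And>x. x \<in> E \<Longrightarrow> \<exists>f. orthogonal_transformation f \<and> (\<forall>z. dist x z \<le> r \<longrightarrow> G z = \<psi> x + f (z - x))"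
    "\<And>z. (\<And>x. x \<in> E \<Longrightarrow> \<sigma> / 2 \<le> dist x z) \<Longrightarrow> G z = z"
    using local_moves[OF dim E(1) r e sep \<psi>] by blast
  obtain H where H: "distorted ((N + 1) * e) H" "\<And>x. norm x \<le> 2 * d \<Longrightarrow> H x = A x"
    "\<And>x. card E \<le> CARD('n) \<Longrightarrow> 2 * d * T \<le> norm x \<Longrightarrow> H x = x"
  proof (cases "card E \<le> CARD('n)")
    case True
    have "0 < 2 * d" using dpos by simp
    from slow_reflections[OF vs(3)[OF True] vs(1) this e] obtain H where
      H: "distorted (length vs * e) H" "\<And>x. norm x \<le> 2 * d \<Longrightarrow> H x = A x"
      "\<And>x. 2 * d * T \<le> norm x \<Longrightarrow> H x = x" unfolding T' A_def by blast
    have "length vs * e \<le> (N + 1) * e" using vs(2) e by (intro mult_right_mono) (auto simp: N_def)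
    from that[OF distorted_mono[OF H(1) this] H(2,3)] show ?thesis .
  next
    \<comment> \<open>With \<open>CARD('n) + 1\<close> points the orientation may be forced, so
      \<open>A\<close> is kept on the whole space and nothing is claimed far away.\<close>
    case False
    have "distorted ((N + 1) * e) A"
      using distorted_mono[OF distorted_affine_isometry[OF A, of 0 0], of "(N + 1) * e"] e N by simp
    then show ?thesis using that False by blast
  qed
  define \<Phi> where "\<Phi> z = x0 + H (G z - x0)" for z
  have "distorted \<epsilon> \<Phi>"
  proof -
    note t = distorted_affine_isometry[OF orthogonal_transformation_id]
    have "distorted (card E * (2 * e)) (\<lambda>z. G z - x0)"
      using distorted_compose_le[OF t[of 0 x0] G(1)] by simp
    then have "distorted ((N + 1) * e + card E * (2 * e)) (\<lambda>z. H (G z - x0))"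
      using distorted_compose_le[OF H(1)] by blast
    moreover have "(N + 1) * e + card E * (2 * e) \<le> \<epsilon>"
    proof -
      have "(N + 1) * e + card E * (2 * e) = (N + 1 + 2 * card E) * e" by (simp add: algebra_simps)
      also have "\<dots> \<le> (4 * N) * e"
      proof (intro mult_right_mono)
        have "real (card E) \<le> N" using E(2) by (simp add: N_def)
        then show "N + 1 + 2 * card E \<le> 4 * N" using N by linarith
      qed (use e in simp)
      finally show ?thesis using N by (simp add: e_def)
    qed
    ultimately have "distorted \<epsilon> (\<lambda>z. H (G z - x0))" by (rule distorted_mono)
    then show ?thesis
      unfolding \<Phi>_def[abs_def] using distorted_compose_le[OF t[of x0 0]] by simp
  qed
  moreover have local: "\<exists>f. orthogonal_transformation f \<and>
      (\<forall>z. dist x z \<le> r \<longrightarrow> \<Phi> z = \<phi> x + f (z - x))" if x: "x \<in> E" for x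
  proof -
    obtain f where f: "orthogonal_transformation f" "\<And>z. dist x z \<le> r \<Longrightarrow> G z = \<psi> x + f (z - x)"
      using G(2)[OF x] by blast
    have "\<Phi> z = \<phi> x + A (f (z - x))" if z: "dist x z \<le> r" for z
    proof -
      have "norm (f (z - x)) \<le> r"
        using z orthogonal_transformation_inv_simps(3)[OF f(1)] by (simp add: dist_norm norm_minus_commute)
      moreover have "norm (\<psi> x - x0) \<le> d + r"
        using \<psi>[OF x] d(1)[OF x] dist_triangle[of x0 "\<psi> x" x] by (simp add: dist_norm norm_minus_commute)
      ultimately have "norm ((\<psi> x - x0) + f (z - x)) \<le> 2 * d"
        using norm_triangle_ineq[of "\<psi> x - x0" "f (z - x)"] rd by linarith
      moreover have "G z - x0 = (\<psi> x - x0) + f (z - x)" using f(2)[OF z] by simp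
      ultimately have "H (G z - x0) = A ((\<psi> x - x0) + f (z - x))" using H(2) by (simp only:)
      also have "\<dots> = \<phi> x - \<phi> x0 + A (f (z - x))" by (simp add: As(1,5) \<psi>_def)
      finally show ?thesis by (simp add: \<Phi>_def x0(2))
    qed
    moreover have "orthogonal_transformation (\<lambda>v. A (f v))"
      using orthogonal_transformation_compose[OF A f(1)] by (simp add: o_def)
    ultimately show ?thesis by (intro exI[of _ "\<lambda>v. A (f v)"]) auto
  qed
  moreover have "\<Phi> x = \<phi> x" if x: "x \<in> E" for x
  proof -
    obtain f where f: "orthogonal_transformation f" "\<And>z. dist x z \<le> r \<Longrightarrow> \<Phi> z = \<phi> x + f (z - x)"
      using local[OF x] by blast
    then show ?thesis
      using f(2)[of x] r(1) linear_0[OF orthogonal_transformation_linear[OF f(1)]] by simp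
  qed
  moreover have R12: "12 * T \<le> R" "12 \<le> R"
  proof -
    have "12 * T * 1 \<le> 12 * T * \<Lambda>" using T1 \<Lambda> by (intro mult_left_mono) auto
    then show "12 * T \<le> R" "12 \<le> R" using R T1 by linarith+
  qed
  moreover have "\<exists>f. orthogonal_transformation f \<and>
        (\<forall>z. (\<forall>y\<in>E - {x}. R * dist x z \<le> dist x y) \<longrightarrow> \<Phi> z = \<phi> x + f (z - x))" if x: "x \<in> E" for x
  proof -
    have "dist x z \<le> r" if z: "\<forall>y\<in>E - {x}. R * dist x z \<le> dist x y" for z
    proof -
      obtain y where y: "y \<in> E" "y \<noteq> x" using other by blast
      then have "R * dist x z \<le> dist x y" using z by blast
      also have "\<dots> \<le> 2 * d" using d(1)[OF x] d(1)[OF y(1)] dist_triangle3[of x y x0] by linarith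
      finally have "R * dist x z \<le> 2 * d" .
      moreover have "12 * T * \<Lambda> * dist x z \<le> R * dist x z" using R by (intro mult_right_mono) auto
      ultimately have "12 * T * \<Lambda> * dist x z \<le> 2 * d" by linarith
      then show ?thesis using T1 \<Lambda> by (simp add: r_def \<sigma>_def field_simps)
    qed
    then show ?thesis using local[OF x] by blast
  qed
  moreover have "\<Phi> z = z" if cE: "card E \<le> CARD('n)" and z: "\<And>x. x \<in> E \<Longrightarrow> R * dist x0 x \<le> dist x0 z" for z
  proof -
    have Rd: "R * d \<le> dist x0 z" using z d(2) by auto
    have "12 * d \<le> R * d" "12 * T * d \<le> R * d" using R12 dpos by (auto intro!: mult_right_mono)
    with Rd have dz: "12 * d \<le> dist x0 z" "12 * T * d \<le> dist x0 z" by linarith+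
    have "G z = z"
    proof (rule G(3))
      fix x assume "x \<in> E"
      then show "\<sigma> / 2 \<le> dist x z"
        using d(1)[of x] dist_triangle[of x0 z x] dz(1) \<sigma>d by linarith
    qed
    moreover have "2 * d * T \<le> norm (z - x0)"
    proof -
      have "12 * (d * T) \<le> norm (z - x0)"
        using dz(2) by (simp add: dist_norm norm_minus_commute mult_ac)
      moreover have "0 \<le> d * T" using dpos T1 by simp
      ultimately show ?thesis by (simp only: mult.assoc)
    qed
    ultimately show ?thesis using H(3)[OF cE] by (simp add: \<Phi>_def)
  qed
  ultimately show ?thesis unfolding controlled_extension_def by blast
qed

section \<open>Induction on the number of points\<close>

lemma controlled_extension_exists:
  assumes dim: "2 \<le> CARD('n::finite)" and k: "k \<le> CARD('n) + 1"
  shows "\<exists>C\<ge>1. \<forall>(E :: (real^'n) set) x0 \<phi> \<epsilon>. finite E \<longrightarrow> card E \<le> k \<longrightarrow> x0 \<in> E \<longrightarrow> \<phi> x0 = x0 \<longrightarrow>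
    0 < \<epsilon> \<longrightarrow> \<epsilon> \<le> 1 \<longrightarrow> near_isometry_on (exp (- C / \<epsilon>)) E \<phi> \<longrightarrow>
    (\<exists>\<Phi>. controlled_extension \<epsilon> (exp (C / \<epsilon>)) E x0 \<phi> \<Phi>)"
  using k
proof (induction k)
  case 0
  then show ?case by (intro exI[of _ 1]) auto
next
  case (Suc k)
  then obtain C where C: "1 \<le> C" and IH: "\<And>(E :: (real^'n) set) x0 \<phi> \<epsilon>. finite E \<Longrightarrow> card E \<le> k \<Longrightarrow>
    x0 \<in> E \<Longrightarrow> \<phi> x0 = x0 \<Longrightarrow> 0 < \<epsilon> \<Longrightarrow> \<epsilon> \<le> 1 \<Longrightarrow> near_isometry_on (exp (- C / \<epsilon>)) E \<phi> \<Longrightarrow>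
    \<exists>\<Phi>. controlled_extension \<epsilon> (exp (C / \<epsilon>)) E x0 \<phi> \<Phi>" by (metis Suc_leD)
  define N where "N = real (CARD('n) + 1)"
  define K where "K = ln (90 * 4 ^ (CARD('n) + 1) :: real)"
  \<comment> \<open>The three exponents belong to the numerical factor in \<open>small\<close>, to
    \<open>T\<close> and to \<open>\<Lambda>\<close>. Only \<open>sqrt \<delta>\<close> has to
    compensate for them, so the new constant is \<open>2 * S\<close>.\<close>
  define S where "S = K + 256 * N + (4 * C + 1) * N"
  have N: "1 \<le> N" by (simp add: N_def)
  have K: "exp K = 90 * 4 ^ (CARD('n) + 1)" unfolding K_def by (intro exp_ln) simp
  have "1 \<le> (4::real) ^ (CARD('n) + 1)" by (rule one_le_power) simp
  then have K90: "90 \<le> exp K" by (simp add: K)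
  have K0: "0 \<le> K"
    unfolding K_def by (rule ln_ge_zero) (use \<open>1 \<le> 4 ^ (CARD('n) + 1)\<close> in linarith)
  have CN: "4 * C + 1 \<le> (4 * C + 1) * N" using mult_left_mono[OF N, of "4 * C + 1"] C by simp
  then have S: "4 * C + 1 \<le> S" "0 \<le> S" unfolding S_def using K0 N C CN by linarith+
  have "\<exists>\<Phi>. controlled_extension \<epsilon> (exp (2 * S / \<epsilon>)) E x0 \<phi> \<Phi>"
    if E: "finite E" "card E \<le> Suc k" and x0: "x0 \<in> E" "\<phi> x0 = x0" and \<epsilon>: "0 < \<epsilon>" "\<epsilon> \<le> 1"
      and near: "near_isometry_on (exp (- (2 * S) / \<epsilon>)) E \<phi>"
    for E :: "(real^'n) set" and x0 \<phi> \<epsilon>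
  proof -
    \<comment> \<open>The ratio that the induction hypothesis yields at \<epsilon>/2, the allowance
      of each of the two composed maps.\<close>
    define R where "R = exp (2 * C / \<epsilon>)"
    define R' where "R' = exp (2 * S / \<epsilon>)"
    define \<delta> where "\<delta> = exp (- (2 * S) / \<epsilon>)"
    have exp_le: "exp (a / \<epsilon>) \<le> exp (b / \<epsilon>)" if "a \<le> b" for a b
      using that \<epsilon> by (simp add: divide_right_mono)
    have exp_ge: "exp a \<le> exp (a / \<epsilon>)" if "0 \<le> a" for a
      using that \<epsilon> by (simp add: field_simps mult_left_le_one_le)
    have e2: "2 \<le> exp (1 / \<epsilon>)"
      using exp_ge[of 1] exp_ge_add_one_self[of 1] by linarith
    have cE: "card E \<le> CARD('n) + 1" using E Suc.prems by simp
    have nearC: "near_isometry_on (exp (- (2 * C) / \<epsilon>)) F \<psi>" if "near_isometry_on \<delta> F \<psi>"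
      for F :: "(real^'n) set" and \<psi>
      using near_isometry_on_mono[OF that order_refl] S C exp_le[of "- (2 * S)" "- (2 * C)"]
      by (simp add: \<delta>_def)
    consider "card E = 1" | "2 \<le> card E"
      using E x0 card_gt_0_iff[of E] by force
    then have "\<exists>\<Phi>. controlled_extension \<epsilon> R' E x0 \<phi> \<Phi>"
    proof cases
      case 1
      \<comment> \<open>For one point the clauses on \<open>z\<close> hold vacuously restricted,
        that is for all \<open>z\<close>, so the identity is the natural choice.\<close>
      then have "E = {x0}" using x0 by (metis card_1_singletonE singletonD)
      moreover have "distorted \<epsilon> (\<lambda>x::real^'n. x)"
        by (rule distorted_mono[OF distorted_id]) (use \<epsilon> in simp)
      moreover have "orthogonal_transformation (\<lambda>x::real^'n. x)" by simp
      ultimately have "controlled_extension \<epsilon> R' E x0 \<phi> (\<lambda>x. x)"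
        unfolding controlled_extension_def using x0 by (auto intro!: exI[of _ "\<lambda>x. x"])
      then show ?thesis by blast
    next
      case 2
      show ?thesis
      proof (rule isolated_cluster_or_comparable[OF E(1), of "R\<^sup>2"])
        show "0 \<le> R\<^sup>2" by simp
      next
        fix F assume F: "F \<subseteq> E" "F \<noteq> E" "2 \<le> card F"
          "\<And>a b c y. a \<in> F \<Longrightarrow> b \<in> F \<Longrightarrow> c \<in> F \<Longrightarrow> y \<in> E - F \<Longrightarrow> R\<^sup>2 * dist a b \<le> dist c y"
        have R: "2 \<le> R" using order_trans[OF e2 exp_le[of 1 "2 * C"]] C by (simp add: R_def)
        have "2 * 2 \<le> exp (1 / \<epsilon>) * exp (1 / \<epsilon>)" using e2 by (intro mult_mono) auto
        then have "4 * R \<le> exp (1 / \<epsilon>) * exp (1 / \<epsilon>) * R" using R by (intro mult_right_mono) auto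
        also have "\<dots> = exp ((2 * C + 2) / \<epsilon>)"
          by (simp add: R_def exp_add[symmetric] add_divide_distrib)
        also have "\<dots> \<le> R'" unfolding R'_def using S C by (intro exp_le) auto
        finally have RR: "4 * R \<le> R'" .
        show ?thesis
        proof (rule controlled_extension_cluster[OF E(1) cE x0 near[folded \<delta>_def] _ F R RR])
          fix E' :: "(real^'n) set" and x0 \<phi>
          assume "finite E'" "card E' < card E" "x0 \<in> E'" "\<phi> x0 = x0" "near_isometry_on \<delta> E' \<phi>"
          then show "\<exists>\<Phi>. controlled_extension (\<epsilon> / 2) R E' x0 \<phi> \<Phi>"
            using IH[of E' x0 \<phi> "\<epsilon> / 2"] nearC[of E' \<phi>] E(2) \<epsilon> by (simp add: R_def mult.commute)
        qed (simp_all add: \<delta>_def)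
      next
        assume comp: "\<And>x y u v. x \<in> E \<Longrightarrow> y \<in> E \<Longrightarrow> x \<noteq> y \<Longrightarrow> u \<in> E \<Longrightarrow> v \<in> E \<Longrightarrow>
          dist u v \<le> (1 + R\<^sup>2) ^ card E * dist x y"
        define \<Lambda> where "\<Lambda> = exp ((4 * C + 1) * N / \<epsilon>)"
        define T where "T = exp (256 * N / \<epsilon>)"
        \<comment> \<open>The square of \<open>R\<close> has exponent
          \<open>4 * C / \<epsilon>\<close>; the additional 1 pays for a factor 2, since
          \<open>2 \<le> exp (1 / \<epsilon>)\<close>.\<close>
        have "1 + R\<^sup>2 \<le> exp ((4 * C + 1) / \<epsilon>)"
        proof -
          have R2: "R\<^sup>2 = exp (4 * C / \<epsilon>)" by (simp add: R_def exp_double[symmetric])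
          have "1 \<le> R\<^sup>2" unfolding R2 using C \<epsilon> by simp
          then have "1 + R\<^sup>2 \<le> 2 * R\<^sup>2" by simp
          also have "\<dots> \<le> exp (1 / \<epsilon>) * R\<^sup>2" using e2 by (intro mult_right_mono) auto
          also have "\<dots> = exp ((4 * C + 1) / \<epsilon>)"
            by (simp add: R2 exp_add[symmetric] add_divide_distrib)
          finally show ?thesis .
        qed
        then have "(1 + R\<^sup>2) ^ card E \<le> exp ((4 * C + 1) / \<epsilon>) ^ card E" by (intro power_mono) auto
        also have "\<dots> \<le> exp ((4 * C + 1) / \<epsilon>) ^ (CARD('n) + 1)"
          using C \<epsilon> cE by (intro power_increasing) auto
        also have "\<dots> = \<Lambda>"
          unfolding \<Lambda>_def N_def by (simp only: exp_of_nat_mult[symmetric]) (simp add: mult_ac)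
        finally have \<Lambda>: "(1 + R\<^sup>2) ^ card E \<le> \<Lambda>" .
        have comp': "dist u v \<le> \<Lambda> * dist x y" if "x \<in> E" "y \<in> E" "x \<noteq> y" "u \<in> E" "v \<in> E" for x y u v
          using comp[OF that] mult_right_mono[OF \<Lambda>, of "dist x y"] by simp
        have prod: "exp (K / \<epsilon>) * T * \<Lambda> = exp (S / \<epsilon>)"
          by (simp add: S_def T_def \<Lambda>_def exp_add[symmetric] add_divide_distrib)
        have T\<Lambda>: "0 \<le> T * \<Lambda>" by (simp add: T_def \<Lambda>_def)
        have "12 * (T * \<Lambda>) \<le> exp (K / \<epsilon>) * (T * \<Lambda>)"
          using order_trans[OF K90 exp_ge[OF K0]] T\<Lambda> by (intro mult_right_mono) auto
        then have "12 * T * \<Lambda> \<le> exp (S / \<epsilon>)" using prod by (simp add: mult.assoc)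
        also have "\<dots> \<le> R'" unfolding R'_def using S(2) by (intro exp_le) simp
        finally have 12: "12 * T * \<Lambda> \<le> R'" .
        have "sqrt \<delta> = exp (- S / \<epsilon>)"
          by (rule real_sqrt_unique) (simp_all add: \<delta>_def exp_double[symmetric])
        then have "exp (S / \<epsilon>) * sqrt \<delta> = 1" by (simp add: exp_add[symmetric])
        then have "exp (K / \<epsilon>) * (T * \<Lambda>) * sqrt \<delta> = 1"
          unfolding prod[symmetric] by (simp only: mult.assoc)
        moreover have "exp K * (T * \<Lambda>) * sqrt \<delta> \<le> exp (K / \<epsilon>) * (T * \<Lambda>) * sqrt \<delta>"
          using exp_ge[OF K0] T\<Lambda> by (intro mult_right_mono) (auto simp: \<delta>_def)
        ultimately have sm: "90 * 4 ^ (CARD('n) + 1) * T * \<Lambda> * sqrt \<delta> \<le> 1"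
          by (simp only: K mult.assoc)
        show ?thesis
        proof (rule controlled_extension_comparable[OF dim E(1) cE 2 x0 \<epsilon> near[folded \<delta>_def] _ _ _ _ _ 12 sm])
          show "0 \<le> \<delta>" "\<delta> \<le> 1" using S \<epsilon> by (simp_all add: \<delta>_def)
          show "1 \<le> \<Lambda>" using C N \<epsilon> by (simp add: \<Lambda>_def)
        qed (use comp' in \<open>simp_all add: T_def N_def\<close>)
      qed
    qed
    then show ?thesis by (simp add: R'_def)
  qed
  then show ?case using S C by (intro exI[of _ "2 * S"]) auto
qed

theorem theorem1p13:
  assumes "CARD('n::finite) \<ge> 2"
  shows "\<exists>c C'. c > 0 \<and> C' > 0 \<and>
    (\<forall>(E :: (real^'n) set) (\<epsilon>::real) (\<phi> :: real^'n \<Rightarrow> real^'n).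
       finite E \<longrightarrow> card E \<le> CARD('n) + 1 \<longrightarrow> 0 < \<epsilon> \<longrightarrow> \<epsilon> < c \<longrightarrow>
       (let \<delta> = exp (- C' / \<epsilon>) in
         (\<forall>x\<in>E. \<forall>y\<in>E. dist x y / (1 + \<delta>) \<le> dist (\<phi> x) (\<phi> y)
                      \<and> dist (\<phi> x) (\<phi> y) \<le> (1 + \<delta>) * dist x y)
         \<longrightarrow> (\<exists>\<Phi>. eps_distorted \<epsilon> \<Phi> \<and> (\<forall>x\<in>E. \<Phi> x = \<phi> x))))"
proof -
  obtain C where C: "1 \<le> C" and ext: "\<And>(E :: (real^'n) set) x0 \<phi> \<epsilon>. finite E \<Longrightarrow> card E \<le> CARD('n) + 1 \<Longrightarrow>
    x0 \<in> E \<Longrightarrow> \<phi> x0 = x0 \<Longrightarrow> 0 < \<epsilon> \<Longrightarrow> \<epsilon> \<le> 1 \<Longrightarrow> near_isometry_on (exp (- C / \<epsilon>)) E \<phi> \<Longrightarrow>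
    \<exists>\<Phi>. controlled_extension \<epsilon> (exp (C / \<epsilon>)) E x0 \<phi> \<Phi>"
    using controlled_extension_exists[OF assms order_refl] by metis
  have "\<exists>\<Phi>. eps_distorted \<epsilon> \<Phi> \<and> (\<forall>x\<in>E. \<Phi> x = \<phi> x)"
    if E: "finite E" "card E \<le> CARD('n) + 1" and \<epsilon>: "0 < \<epsilon>" "\<epsilon> < 1"
      and near: "near_isometry_on (exp (- (4 * C) / \<epsilon>)) E \<phi>"
    for E :: "(real^'n) set" and \<epsilon> \<phi>
  proof (cases "E = {}")
    case True
    have "distorted (\<epsilon> / 4) (\<lambda>x::real^'n. x)"
      by (rule distorted_mono[OF distorted_id]) (use \<epsilon> in simp)
    then show ?thesis using True distorted_imp_eps_distorted \<epsilon> by (metis empty_iff less_imp_le)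
  next
    case False
    then obtain x0 where x0: "x0 \<in> E" by blast
    \<comment> \<open>A translation makes \<open>x0\<close> a fixed point, as the induction demands.
      Extending at \<epsilon>/4 allows for the squared derivative and turns \<open>C\<close> into
      \<open>4 * C\<close>.\<close>
    define \<psi> where "\<psi> x = \<phi> x - \<phi> x0 + x0" for x
    have "near_isometry_on (exp (- C / (\<epsilon> / 4))) E \<psi>"
      using near unfolding near_isometry_on_def \<psi>_def by (simp add: dist_norm mult.commute)
    then obtain \<Phi> where \<Phi>: "controlled_extension (\<epsilon> / 4) (exp (C / (\<epsilon> / 4))) E x0 \<psi> \<Phi>"
      using ext[OF E x0, of \<psi> "\<epsilon> / 4"] \<epsilon> by (auto simp: \<psi>_def)
    have "distorted (\<epsilon> / 4) (\<lambda>z. \<phi> x0 + (\<Phi> z - x0))"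
      using distorted_compose_le[OF distorted_affine_isometry[OF orthogonal_transformation_id]
          controlled_extensionD(1)[OF \<Phi>]] by simp
    then have "eps_distorted \<epsilon> (\<lambda>z. \<phi> x0 + (\<Phi> z - x0))"
      by (rule distorted_imp_eps_distorted) (use \<epsilon> in auto)
    then show ?thesis
      using controlled_extensionD(2)[OF \<Phi>] by (intro exI[of _ "\<lambda>z. \<phi> x0 + (\<Phi> z - x0)"]) (auto simp: \<psi>_def)
  qed
  then show ?thesis
    using C unfolding Let_def near_isometry_on_def
    by (intro exI[of _ 1] exI[of _ "4 * C"]) auto
qed

end
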